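(* Let $d\in\mathbb N$. For every $d$-tuple of contractions $A_1,\dots,A_d$ on a Hilbert space $H$ there exist a Hilbert space $K$, an isometry $V:H\to K$, and $d$ commuting normal operators $T_1,\dots,T_d$ on $K$ satisfying $\|T_i\|\le 2d$ for $i=1,\dots,d$ such that $$A_i=V^*T_iV,\qquad i=1,\dots,d.$$ Consequently, for all $d$, $\mathcal W^{\max}(\overline{\mathbb D}^d)\subseteq 2d\,\mathcal W^{\min}(\overline{\mathbb D}^d)$.
   Context: $\overline{\mathbb D}$ is the closed unit disc in $\mathbb C$ and $M_n$ is the algebra of $n\times n$ complex matrices. For a closed convex set $C\subseteq\mathbb C^d$ (here $C=\overline{\mathbb D}^d$), $\mathcal W^{\min}(C)=\bigcup_n\mathcal W^{\min}_n(C)$, where $\mathcal W^{\min}_n(C)$ is the set of $X\in M_n^d$ for which there are a Hilbert space $L$, a tuple $N=(N_1,\dots,N_d)$ of commuting normal operators on $L$ with joint spectrum $\sigma(N)\subseteq C$, and an isometry $W:\mathbb C^n\to L$ with $X_i=W^*N_iW$ for all $i$. Also $\mathcal W^{\max}(C)=\bigcup_n\mathcal W^{\max}_n(C)$, where $\mathcal W^{\max}_n(C)$ is the set of $X\in M_n^d$ such that $\operatorname{Re}\sum_i\alpha_iX_i\le aI_n$ whenever $\alpha\in\mathbb C^d$, $a\in\mathbb R$ satisfy $\operatorname{Re}\sum_i\alpha_iz_i\le a$ for all $z\in C$. Here $\operatorname{Re}T=\frac12(T+T^* )$. For $c>0$ and a set $\mathcal S$ of tuples, $c\,\mathcal S=\{cX:X\in\mathcal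 S\}$; inclusion means inclusion at every level $n$. *)

theory Defs
  imports "HOL-Analysis.Analysis" "HOL-Algebra.Module"
begin

section \<open>Complex Hilbert spaces with explicit carriers\<close>

text \<open>
  Dilation spaces are existentially quantified, which rules out a type-class
  rendering; Hilbert spaces are therefore structures with a carrier set, namely modules
  over the field of complex numbers with an inner product (linear in the first argument).
  The fields \<open>mult\<close> and \<open>one\<close>, which the library's module record inherits from rings, carry
  no meaning here.
\<close>

definition complex_field :: "complex ring" where
  "complex_field = \<lparr>carrier = UNIV, mult = (*), one = 1, zero = 0, add = (+)\<rparr>"

record 'a hilbert = "(complex, 'a) module" +
  hinner :: "'a \<Rightarrow> 'a \<Rightarrow> complex"

definition hnorm :: "'a hilbert \<Rightarrow> 'a \<Rightarrow> real" where
  "hnorm H x = sqrt (Re (hinner H x x))"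

definition hdist :: "'a hilbert \<Rightarrow> 'a \<Rightarrow> 'a \<Rightarrow> real" where
  "hdist H x y = hnorm H (x \<ominus>\<^bsub>H\<^esub> y)"

locale hilbert_space = Module.module complex_field H
  for H :: "'a hilbert" +
  assumes hinner_add_left: "\<lbrakk>x \<in> carrier H; y \<in> carrier H; z \<in> carrier H\<rbrakk> \<Longrightarrow>
      hinner H (x \<oplus>\<^bsub>H\<^esub> y) z = hinner H x z + hinner H y z"
    and hinner_smult_left: "\<lbrakk>x \<in> carrier H; y \<in> carrier H\<rbrakk> \<Longrightarrow>
      hinner H (c \<odot>\<^bsub>H\<^esub> x) y = c * hinner H x y"
    and hinner_commute: "\<lbrakk>x \<in> carrier H; y \<in> carrier H\<rbrakk> \<Longrightarrow>
      hinner H x y = cnj (hinner H y x)"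
    and hinner_pos: "\<lbrakk>x \<in> carrier H; x \<noteq> \<zero>\<^bsub>H\<^esub>\<rbrakk> \<Longrightarrow> Re (hinner H x x) > 0"
    and complete: "Metric_space.mcomplete (carrier H) (hdist H)"

section \<open>Operators\<close>

text \<open>
  An operator is a function on the underlying type of which only the values on the
  carrier matter; identities between operators are stated pointwise on the carrier.
\<close>

definition linear_op :: "'a hilbert \<Rightarrow> 'b hilbert \<Rightarrow> ('a \<Rightarrow> 'b) \<Rightarrow> bool" where
  "linear_op H K T \<longleftrightarrow> T \<in> carrier H \<rightarrow> carrier K \<and>
     (\<forall>x\<in>carrier H. \<forall>y\<in>carrier H. T (x \<oplus>\<^bsub>H\<^esub> y) = T x \<oplus>\<^bsub>K\<^esub> T y) \<and>
     (\<forall>c. \<forall>x\<in>carrier H. T (c \<odot>\<^bsub>H\<^esub> x) = c \<odot>\<^bsub>K\<^esub> T x)"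

definition bounded_op :: "'a hilbert \<Rightarrow> 'b hilbert \<Rightarrow> ('a \<Rightarrow> 'b) \<Rightarrow> bool" where
  "bounded_op H K T \<longleftrightarrow> linear_op H K T \<and>
     (\<exists>b. \<forall>x\<in>carrier H. hnorm K (T x) \<le> b * hnorm H x)"

definition opnorm :: "'a hilbert \<Rightarrow> 'b hilbert \<Rightarrow> ('a \<Rightarrow> 'b) \<Rightarrow> real" where
  "opnorm H K T = (SUP x \<in> {x \<in> carrier H. hnorm H x \<le> 1}. hnorm K (T x))"

definition contraction :: "'a hilbert \<Rightarrow> ('a \<Rightarrow> 'a) \<Rightarrow> bool" where
  "contraction H T \<longleftrightarrow> bounded_op H H T \<and> opnorm H H T \<le> 1"

definition isometry :: "'a hilbert \<Rightarrow> 'b hilbert \<Rightarrow> ('a \<Rightarrow> 'b) \<Rightarrow> bool" where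
  "isometry H K V \<longleftrightarrow> linear_op H K V \<and> (\<forall>x\<in>carrier H. hnorm K (V x) = hnorm H x)"

text \<open>
  The defining property of the adjoint; for bounded operators between Hilbert spaces the
  vector described exists and is unique by the Riesz representation theorem.
\<close>

definition adj :: "'a hilbert \<Rightarrow> 'b hilbert \<Rightarrow> ('a \<Rightarrow> 'b) \<Rightarrow> 'b \<Rightarrow> 'a" where
  "adj H K T y = (THE x. x \<in> carrier H \<and>
     (\<forall>z\<in>carrier H. hinner K (T z) y = hinner H z x))"

definition normal_op :: "'a hilbert \<Rightarrow> ('a \<Rightarrow> 'a) \<Rightarrow> bool" where
  "normal_op H T \<longleftrightarrow> bounded_op H H T \<and>
     (\<forall>x\<in>carrier H. adj H H T (T x) = T (adj H H T x))"

definition commuting_normal :: "'a hilbert \<Rightarrow> ('d \<Rightarrow> 'a \<Rightarrow> 'a) \<Rightarrow> bool" where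
  "commuting_normal H N \<longleftrightarrow> (\<forall>i. normal_op H (N i)) \<and>
     (\<forall>i j. \<forall>x\<in>carrier H. N i (N j x) = N j (N i x))"

text \<open>
  The (Harte) joint spectrum: \<open>z\<close> lies outside it iff the operators \<open>N i - z i\<close> generate the
  full algebra of bounded operators both as a left and as a right ideal. For a single
  operator this is the usual spectrum; for commuting normal operators it agrees with the
  Gelfand joint spectrum of the C*-algebra they generate and with the Taylor spectrum.
\<close>

definition joint_spectrum :: "'a hilbert \<Rightarrow> ('d::finite \<Rightarrow> 'a \<Rightarrow> 'a) \<Rightarrow> (complex ^ 'd) set" where
  "joint_spectrum H N = {z. \<not> (
     (\<exists>B. (\<forall>i. bounded_op H H (B i)) \<and>
        (\<forall>x\<in>carrier H. (\<Oplus>\<^bsub>H\<^esub>i\<in>UNIV. B i (N i x \<ominus>\<^bsub>H\<^esub> (z $ i) \<odot>\<^bsub>H\<^esub> x)) = x)) \<and>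
     (\<exists>B. (\<forall>i. bounded_op H H (B i)) \<and>
        (\<forall>x\<in>carrier H. (\<Oplus>\<^bsub>H\<^esub>i\<in>UNIV. N i (B i x) \<ominus>\<^bsub>H\<^esub> (z $ i) \<odot>\<^bsub>H\<^esub> B i x) = x)))}"

section \<open>Matrices\<close>

definition cvec_space :: "(complex ^ 'n) hilbert" where
  "cvec_space = \<lparr>carrier = UNIV, mult = (\<lambda>_ _. 0), one = 0, zero = 0, add = (+),
     smult = (*s), hinner = (\<lambda>x y. \<Sum>i\<in>UNIV. x $ i * cnj (y $ i))\<rparr>"

lemma hnorm_cvec_space: "hnorm cvec_space x = norm x"
proof -
  have "Re (hinner cvec_space x x) = (\<Sum>i\<in>UNIV. (norm (x$i))^2)"
    by (simp add: cvec_space_def complex_norm_square[symmetric] cmod_def power2_eq_square)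
  then show ?thesis by (simp add: hnorm_def norm_vec_def L2_set_def)
qed

lemma abelian_group_cvec_space: "abelian_group (cvec_space :: (complex^'n) hilbert)"
  by (rule abelian_groupI) (auto simp: cvec_space_def add.assoc add.commute intro: exI[of _ "- _"] simp del: add_uminus_conv_diff,
      metis add.commute add.right_inverse)

lemma hdist_cvec_space: "hdist cvec_space = (dist :: complex^'n \<Rightarrow> _)"
proof (intro ext)
  fix x y :: "complex^'n"
  interpret abelian_group "cvec_space :: (complex^'n) hilbert" by (rule abelian_group_cvec_space)
  have "\<ominus>\<^bsub>cvec_space\<^esub> y = - y"
    by (rule minus_equality) (auto simp: cvec_space_def)
  then show "hdist cvec_space x y = dist x y"
    by (simp add: hdist_def hnorm_cvec_space a_minus_def dist_norm) (simp add: cvec_space_def)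
qed

lemma hilbert_space_cvec_space: "hilbert_space (cvec_space :: (complex^'n) hilbert)"
proof -
  interpret abelian_group "cvec_space :: (complex^'n) hilbert" by (rule abelian_group_cvec_space)
  have cr: "cring complex_field" 
    by (rule cringI, rule abelian_groupI)
       (auto simp: complex_field_def algebra_simps comm_monoid_def intro!: monoid.intro comm_monoid_axioms.intro,
        metis add.commute add.right_inverse)
  have m: "Module.module complex_field (cvec_space :: (complex^'n) hilbert)"
    by (rule moduleI[OF cr abelian_group_cvec_space]) (auto simp: complex_field_def cvec_space_def vec_eq_iff algebra_simps)
  have p: "x \<noteq> 0 \<Longrightarrow> Re (hinner cvec_space x x) > 0" for x :: "complex^'n"
    using hnorm_cvec_space[of x] by (simp add: hnorm_def) (metis norm_eq_zero less_eq_real_def linorder_not_le norm_ge_zero real_sqrt_gt_0_iff zero_less_norm_iff)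
  have c: "Metric_space.mcomplete UNIV (dist :: complex^'n \<Rightarrow> _)"
    by (metis complete_UNIV mcomplete_iff_complete)
  show ?thesis
    apply (intro hilbert_space.intro hilbert_space_axioms.intro m)
    subgoal by (simp add: cvec_space_def algebra_simps sum.distrib)
    subgoal by (simp add: cvec_space_def algebra_simps sum_distrib_left)
    subgoal by (simp add: cvec_space_def algebra_simps)
    subgoal using p by (simp add: cvec_space_def)
    subgoal using c by (simp add: hdist_cvec_space) (simp add: cvec_space_def)
    done
qed

definition mat_adj :: "complex ^ 'n ^ 'n \<Rightarrow> complex ^ 'n ^ 'n" where
  "mat_adj X = map_matrix cnj (Finite_Cartesian_Product.transpose X)"

definition mat_Re :: "complex ^ 'n ^ 'n \<Rightarrow> complex ^ 'n ^ 'n" where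
  "mat_Re X = (1 / 2) *\<^sub>R (X + mat_adj X)"

definition psd :: "complex ^ 'n ^ 'n \<Rightarrow> bool" where
  "psd X \<longleftrightarrow> mat_adj X = X \<and> (\<forall>v. Re (hinner cvec_space (X *v v) v) \<ge> 0)"

definition loewner_le :: "complex ^ 'n ^ 'n \<Rightarrow> complex ^ 'n ^ 'n \<Rightarrow> bool" where
  "loewner_le X Y \<longleftrightarrow> psd (Y - X)"

section \<open>Minimal and maximal matrix convex sets\<close>

text \<open>
  The types \<open>'d\<close> and \<open>'n\<close> index the \<open>d\<close> coordinates and the rows and columns of \<open>n \<times> n\<close>
  matrices: \<open>W_min C :: ('d \<Rightarrow> complex ^ 'n ^ 'n) set\<close> is the \<open>n\<close>-th level of the minimal
  matrix convex set over \<open>C\<close>, and similarly for \<open>W_max\<close>.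

  The Hilbert space \<open>L\<close> in \<open>W_min\<close> ranges over all structures whose carrier is contained in
  the type \<open>nat \<Rightarrow> complex\<close>. Up to unitary equivalence this includes every separable Hilbert
  space, and there is no loss in that: a larger dilation space can be replaced by the
  closed linear span of the vectors \<open>p(N, N*) W v\<close> (\<open>p\<close> a polynomial, \<open>v\<close> in \<open>C^n\<close>),
  which is separable and reduces all \<open>N i\<close>, so that passing to it does not enlarge the
  joint spectrum.
\<close>

definition W_min :: "(complex ^ 'd) set \<Rightarrow> ('d::finite \<Rightarrow> complex ^ 'n ^ 'n) set" where
  "W_min C = {X. \<exists>(L :: (nat \<Rightarrow> complex) hilbert) N W.
     hilbert_space L \<and> commuting_normal L N \<and> joint_spectrum L N \<subseteq> C \<and>
     isometry cvec_space L W \<and>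
     (\<forall>i v. X i *v v = adj cvec_space L W (N i (W v)))}"

definition W_max :: "(complex ^ 'd) set \<Rightarrow> ('d::finite \<Rightarrow> complex ^ 'n ^ 'n) set" where
  "W_max C = {X. \<forall>(\<alpha> :: complex ^ 'd) (a :: real).
     (\<forall>z\<in>C. Re (\<Sum>i\<in>UNIV. \<alpha> $ i * z $ i) \<le> a) \<longrightarrow>
     loewner_le (mat_Re (\<Sum>i\<in>UNIV. map_matrix ((*) (\<alpha> $ i)) (X i))) (mat (of_real a))}"

definition scale_tuples ::
  "real \<Rightarrow> ('d \<Rightarrow> complex ^ 'n ^ 'n) set \<Rightarrow> ('d \<Rightarrow> complex ^ 'n ^ 'n) set" where
  "scale_tuples c S = (\<lambda>X i. c *\<^sub>R X i) ` S"

definition closed_polydisc :: "(complex ^ 'd) set" where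
  "closed_polydisc = {z. \<forall>i. z $ i \<in> cball 0 1}"

end

theory Submission
  imports Defs
begin

text \<open>
  Write \<open>A\<^sub>i = R\<^sub>i + M\<^sub>i\<close> with \<open>R\<^sub>i = Re A\<^sub>i\<close> and \<open>M\<^sub>i = i Im A\<^sub>i\<close>, and give each of the \<open>2d\<close> operators
  \<open>R\<^sub>i, M\<^sub>i\<close> its own summand of \<open>K = H\<^bsup>2d\<^esup>\<close>. Let \<open>T\<^sub>i\<close> be \<open>2d R\<^sub>i\<close> on the first of its two summands, \<open>2d M\<^sub>i\<close>
  on the second and zero elsewhere. These operators are normal and commute, and they compress to \<open>A\<^sub>i\<close>
  along the diagonal embedding \<open>V x = (x, \<dots>, x) / sqrt (2d)\<close>. Only the bound \<open>|\<langle>A\<^sub>i x, x\<rangle>| \<le> \<parallel>x\<parallel>\<^sup>2\<close> is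
  needed for \<open>\<parallel>R\<^sub>i\<parallel>, \<parallel>M\<^sub>i\<parallel> \<le> 1\<close>, and that bound is what membership in \<open>W_max\<close> gives.

  A pitfall: \<^const>\<open>Metric_space.mcomplete\<close> is specified only for functions that are symmetric and
  nonnegative on the whole type, which \<open>hdist H\<close> need not be outside \<open>carrier H\<close>. The completeness
  assumption on \<open>H\<close> is therefore not usable, and \<open>H\<close> is completed before the construction is applied.
\<close>

text \<open>The constant 2d is the number of summands: a diagonal vector has the fraction 1/(2d) of
  its squared length in each of them, so a block has to be enlarged 2d times to survive compression
  with its original size. Splitting into self-adjoint and skew-adjoint parts makes every block
  normal, and different T_i commute because they live on disjoint pairs of summands. With the factor
  1 in place of 2d the same construction gives commuting normal contractions compressing to
  A_i/(2d); their joint spectrum lies in the polydisc, which yields the matrix inclusion. The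
  Cartesian parts require an adjoint of A_i, hence the Riesz theorem, hence a space whose
  completeness can be exploited. Completion and direct sum are both spaces of families modulo the
  null vectors of a semi-inner product, so one quotient construction serves for both. Its elements
  are chosen representatives, or codes of families, instead of equivalence classes; this keeps the
  dilation spaces inside the types \<open>nat \<Rightarrow> 'a\<close> and
  \<open>nat \<Rightarrow> complex\<close>.\<close>

section \<open>Pre-Hilbert spaces\<close>

lemma complex_field_simps [simp]:
  "carrier complex_field = UNIV" "a \<otimes>\<^bsub>complex_field\<^esub> b = a * b" "a \<oplus>\<^bsub>complex_field\<^esub> b = a + b"
  "\<one>\<^bsub>complex_field\<^esub> = 1" "\<zero>\<^bsub>complex_field\<^esub> = 0"
  by (simp_all add: complex_field_def)

text \<open>The axioms of \<open>hilbert_space\<close> apart from completeness, so that the algebra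
  and the inequalities below also apply to quotients whose completeness has yet to be
  proved.\<close>

locale pre_hilbert_space = Module.module complex_field H
  for H :: "'a hilbert" +
  assumes hinner_add_left: "\<lbrakk>x \<in> carrier H; y \<in> carrier H; z \<in> carrier H\<rbrakk> \<Longrightarrow>
      hinner H (x \<oplus>\<^bsub>H\<^esub> y) z = hinner H x z + hinner H y z"
    and hinner_smult_left: "\<lbrakk>x \<in> carrier H; y \<in> carrier H\<rbrakk> \<Longrightarrow>
      hinner H (c \<odot>\<^bsub>H\<^esub> x) y = c * hinner H x y"
    and hinner_commute: "\<lbrakk>x \<in> carrier H; y \<in> carrier H\<rbrakk> \<Longrightarrow>
      hinner H x y = cnj (hinner H y x)"
    and hinner_pos: "\<lbrakk>x \<in> carrier H; x \<noteq> \<zero>\<^bsub>H\<^esub>\<rbrakk> \<Longrightarrow> Re (hinner H x x) > 0"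
begin

lemma hinner_add_right:
  assumes "x \<in> carrier H" "y \<in> carrier H" "z \<in> carrier H"
  shows "hinner H x (y \<oplus>\<^bsub>H\<^esub> z) = hinner H x y + hinner H x z"
  using assms by (metis M.a_closed complex_cnj_add hinner_add_left hinner_commute)

lemma hinner_smult_right:
  assumes "x \<in> carrier H" "y \<in> carrier H"
  shows "hinner H x (c \<odot>\<^bsub>H\<^esub> y) = cnj c * hinner H x y"
  using assms
  by (metis UNIV_I complex_cnj_mult complex_field_simps(1) hinner_commute hinner_smult_left smult_closed)

lemma hinner_zero_left [simp]: "x \<in> carrier H \<Longrightarrow> hinner H \<zero>\<^bsub>H\<^esub> x = 0"
  using hinner_add_left[of "\<zero>\<^bsub>H\<^esub>" "\<zero>\<^bsub>H\<^esub>" x] by simp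

lemma hinner_zero_right [simp]: "x \<in> carrier H \<Longrightarrow> hinner H x \<zero>\<^bsub>H\<^esub> = 0"
  using hinner_add_right[of x "\<zero>\<^bsub>H\<^esub>" "\<zero>\<^bsub>H\<^esub>"] by simp

lemma hinner_diff_left:
  assumes "x \<in> carrier H" "y \<in> carrier H" "z \<in> carrier H"
  shows "hinner H (x \<ominus>\<^bsub>H\<^esub> y) z = hinner H x z - hinner H y z"
proof -
  have "hinner H (\<ominus>\<^bsub>H\<^esub> y) z + hinner H y z = 0"
    using assms by (simp flip: hinner_add_left add: M.l_neg)
  then show ?thesis
    using assms by (simp add: a_minus_def hinner_add_left eq_neg_iff_add_eq_0)
qed

lemma hinner_diff_right:
  assumes "x \<in> carrier H" "y \<in> carrier H" "z \<in> carrier H"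
  shows "hinner H x (y \<ominus>\<^bsub>H\<^esub> z) = hinner H x y - hinner H x z"
  using assms by (metis M.minus_closed complex_cnj_diff hinner_commute hinner_diff_left)

lemmas hinner_simps = hinner_add_left hinner_add_right hinner_diff_left hinner_diff_right
  hinner_smult_left hinner_smult_right

lemma smult_closed' [simp, intro]: "x \<in> carrier H \<Longrightarrow> c \<odot>\<^bsub>H\<^esub> x \<in> carrier H"
  by simp

lemma hinner_self_nonneg: "x \<in> carrier H \<Longrightarrow> Re (hinner H x x) \<ge> 0"
  using hinner_pos[of x] by (cases "x = \<zero>\<^bsub>H\<^esub>") auto

lemma hnorm_nonneg [simp]: "x \<in> carrier H \<Longrightarrow> hnorm H x \<ge> 0"
  by (simp add: hnorm_def hinner_self_nonneg)

lemma hnorm_square: "x \<in> carrier H \<Longrightarrow> (hnorm H x)\<^sup>2 = Re (hinner H x x)"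
  by (simp add: hnorm_def hinner_self_nonneg)

lemma hinner_self: "x \<in> carrier H \<Longrightarrow> hinner H x x = of_real ((hnorm H x)\<^sup>2)"
  using hinner_commute[of x x] by (auto simp: hnorm_square complex_eq_iff)

lemma hnorm_zero [simp]: "hnorm H \<zero>\<^bsub>H\<^esub> = 0"
  by (simp add: hnorm_def)

lemma hnorm_eq_0 [simp]: "x \<in> carrier H \<Longrightarrow> hnorm H x = 0 \<longleftrightarrow> x = \<zero>\<^bsub>H\<^esub>"
  using hinner_pos[of x] by (cases "x = \<zero>\<^bsub>H\<^esub>") (auto simp: hnorm_def)

lemma minus_eq_zero_iff:
  assumes "x \<in> carrier H" "y \<in> carrier H"
  shows "x \<ominus>\<^bsub>H\<^esub> y = \<zero>\<^bsub>H\<^esub> \<longleftrightarrow> x = y"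
proof
  assume *: "x \<ominus>\<^bsub>H\<^esub> y = \<zero>\<^bsub>H\<^esub>"
  have "x = (x \<ominus>\<^bsub>H\<^esub> y) \<oplus>\<^bsub>H\<^esub> y"
    using assms by (simp add: a_minus_def M.a_assoc M.l_neg)
  then show "x = y" using assms * by simp
qed (use assms in \<open>simp add: a_minus_def M.r_neg\<close>)

text \<open>Take z to be the difference of the two vectors. This is the workhorse for vector
  identities: after pairing with z, \<open>hinner_simps\<close> turns them into identities of
  complex numbers.\<close>

lemma hinner_eqI:
  assumes "x \<in> carrier H" "y \<in> carrier H" "\<And>z. z \<in> carrier H \<Longrightarrow> hinner H z x = hinner H z y"
  shows "x = y"
proof -
  have "hinner H (x \<ominus>\<^bsub>H\<^esub> y) (x \<ominus>\<^bsub>H\<^esub> y) = 0"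
    using assms by (simp add: hinner_diff_right)
  then have "x \<ominus>\<^bsub>H\<^esub> y = \<zero>\<^bsub>H\<^esub>"
    using assms by (metis M.minus_closed hinner_pos less_irrefl zero_complex.simps(1))
  then show ?thesis using assms by (simp add: minus_eq_zero_iff)
qed

lemma hnorm_smult [simp]:
  assumes "x \<in> carrier H"
  shows "hnorm H (c \<odot>\<^bsub>H\<^esub> x) = cmod c * hnorm H x"
proof -
  have "hinner H (c \<odot>\<^bsub>H\<^esub> x) (c \<odot>\<^bsub>H\<^esub> x) = (c * cnj c) * hinner H x x"
    using assms by (simp add: hinner_simps)
  also have "\<dots> = of_real ((cmod c * hnorm H x)\<^sup>2)"
    using assms by (simp add: complex_norm_square[symmetric] hinner_self power_mult_distrib)
  finally have "(hnorm H (c \<odot>\<^bsub>H\<^esub> x))\<^sup>2 = (cmod c * hnorm H x)\<^sup>2"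
    using assms by (simp add: hnorm_square)
  then show ?thesis using assms by (simp add: power2_eq_iff_nonneg)
qed

lemma cauchy_schwarz:
  assumes "x \<in> carrier H" "y \<in> carrier H"
  shows "cmod (hinner H x y) \<le> hnorm H x * hnorm H y"
proof (cases "y = \<zero>\<^bsub>H\<^esub>")
  case True
  then show ?thesis using assms by simp
next
  case False
  \<comment> \<open>\<open>?z\<close> is the component of x orthogonal to y, multiplied by the
    squared norm of y to avoid division.\<close>
  let ?a = "of_real ((hnorm H y)\<^sup>2)" and ?c = "hinner H x y"
  let ?z = "?a \<odot>\<^bsub>H\<^esub> x \<ominus>\<^bsub>H\<^esub> ?c \<odot>\<^bsub>H\<^esub> y"
  have yx: "hinner H y x = cnj ?c" using assms hinner_commute by blast
  have "hinner H ?z ?z = ?a * (?a * of_real ((hnorm H x)\<^sup>2) - ?c * cnj ?c)"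
    using assms by (simp add: hinner_simps yx hinner_self[OF assms(1)] hinner_self[OF assms(2)] algebra_simps)
  also have "\<dots> = of_real ((hnorm H y)\<^sup>2 * ((hnorm H y)\<^sup>2 * (hnorm H x)\<^sup>2 - (cmod ?c)\<^sup>2))"
    by (simp add: complex_norm_square[symmetric])
  finally have "Re (hinner H ?z ?z) = (hnorm H y)\<^sup>2 * ((hnorm H y)\<^sup>2 * (hnorm H x)\<^sup>2 - (cmod ?c)\<^sup>2)"
    by (simp only: Re_complex_of_real)
  moreover have "Re (hinner H ?z ?z) \<ge> 0" using assms by (simp add: hinner_self_nonneg)
  ultimately have "0 \<le> (hnorm H y)\<^sup>2 * (hnorm H x)\<^sup>2 - (cmod ?c)\<^sup>2"
    using False assms by (simp add: zero_le_mult_iff)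
  then have "(cmod ?c)\<^sup>2 \<le> (hnorm H x * hnorm H y)\<^sup>2" by (simp add: power_mult_distrib mult.commute)
  then show ?thesis by (rule power2_le_imp_le) (use assms in simp)
qed

lemma hnorm_triangle:
  assumes "x \<in> carrier H" "y \<in> carrier H"
  shows "hnorm H (x \<oplus>\<^bsub>H\<^esub> y) \<le> hnorm H x + hnorm H y"
proof -
  have "(hnorm H (x \<oplus>\<^bsub>H\<^esub> y))\<^sup>2 = (hnorm H x)\<^sup>2 + (hnorm H y)\<^sup>2 + 2 * Re (hinner H x y)"
    using assms hinner_commute[of y x] by (simp add: hnorm_square hinner_simps)
  also have "\<dots> \<le> (hnorm H x + hnorm H y)\<^sup>2"
    using cauchy_schwarz[OF assms] complex_Re_le_cmod[of "hinner H x y"] by (simp add: power2_sum)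
  finally show ?thesis by (rule power2_le_imp_le) (use assms in simp)
qed

lemma hdist_commute:
  assumes "x \<in> carrier H" "y \<in> carrier H"
  shows "hdist H x y = hdist H y x"
  using assms by (simp add: hdist_def hnorm_def hinner_simps algebra_simps)

lemma hdist_triangle:
  assumes "x \<in> carrier H" "y \<in> carrier H" "z \<in> carrier H"
  shows "hdist H x z \<le> hdist H x y + hdist H y z"
proof -
  have "x \<ominus>\<^bsub>H\<^esub> z = (x \<ominus>\<^bsub>H\<^esub> y) \<oplus>\<^bsub>H\<^esub> (y \<ominus>\<^bsub>H\<^esub> z)"
    by (rule hinner_eqI) (use assms in \<open>auto simp: hinner_simps\<close>)
  then show ?thesis using assms by (simp add: hdist_def hnorm_triangle)
qed

end

section \<open>Quotients of spaces of families by a semi-inner product\<close>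

context pre_hilbert_space
begin

lemma minus_eq_smult:
  assumes "x \<in> carrier H" "y \<in> carrier H"
  shows "x \<ominus>\<^bsub>H\<^esub> y = x \<oplus>\<^bsub>H\<^esub> (-1) \<odot>\<^bsub>H\<^esub> y"
  by (rule hinner_eqI) (use assms in \<open>auto simp: hinner_simps\<close>)

lemma adj_eqI:
  assumes "x \<in> carrier H" "\<And>z. z \<in> carrier H \<Longrightarrow> hinner K (T z) y = hinner H z x"
  shows "adj H K T y = x"
  unfolding adj_def
  by (rule the_equality) (use assms hinner_eqI in auto)

text \<open>The adjoint is handed over explicitly as \<open>S\<close>. For block operators it is
  known block by block, and \<open>adj_eqI\<close> identifies it with the definite description
  \<open>adj\<close>.\<close>

lemma normal_opI:
  assumes "bounded_op H H T" "S \<in> carrier H \<rightarrow> carrier H"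
    and adj: "\<And>x y. \<lbrakk>x \<in> carrier H; y \<in> carrier H\<rbrakk> \<Longrightarrow> hinner H (T x) y = hinner H x (S y)"
    and comm: "\<And>x. x \<in> carrier H \<Longrightarrow> T (S x) = S (T x)"
  shows "normal_op H T"
proof -
  have *: "adj H H T y = S y" if "y \<in> carrier H" for y
    by (rule adj_eqI) (use that assms in auto)
  have "T \<in> carrier H \<rightarrow> carrier H" using assms(1) by (simp add: bounded_op_def linear_op_def)
  then show ?thesis using assms(1) comm by (auto simp: normal_op_def * Pi_iff)
qed

text \<open>Only distances between carrier vectors occur, and there \<open>hdist\<close> behaves
  like a metric in every pre-Hilbert space.\<close>

definition cauchy_seq :: "(nat \<Rightarrow> 'a) \<Rightarrow> bool" where
  "cauchy_seq s \<longleftrightarrow> (\<forall>n. s n \<in> carrier H) \<and>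
     (\<forall>e>0. \<exists>N. \<forall>m\<ge>N. \<forall>n\<ge>N. hdist H (s m) (s n) < e)"

end

section \<open>Completeness in terms of sequences\<close>

lemma hilbert_space_imp_pre: "hilbert_space H \<Longrightarrow> pre_hilbert_space H"
  unfolding hilbert_space_def pre_hilbert_space_def hilbert_space_axioms_def
    pre_hilbert_space_axioms_def by blast

locale complete_space = pre_hilbert_space +
  assumes cauchy_converges:
    "cauchy_seq s \<Longrightarrow> \<exists>x\<in>carrier H. (\<lambda>n. hdist H (s n) x) \<longlonglongrightarrow> 0"

lemma (in Metric_space) mcomplete_iff_sequential:
  "mcomplete \<longleftrightarrow> (\<forall>s. (\<forall>n. s n \<in> M) \<and> (\<forall>e>0. \<exists>N. \<forall>m\<ge>N. \<forall>n\<ge>N. d (s m) (s n) < e)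
      \<longrightarrow> (\<exists>x\<in>M. (\<lambda>n. d (s n) x) \<longlonglongrightarrow> 0))"
proof -
  have "limitin mtopology s x sequentially \<longleftrightarrow> x \<in> M \<and> (\<lambda>n. d (s n) x) \<longlonglongrightarrow> 0" if "\<forall>n. s n \<in> M" for s x
    using that by (simp add: limitin_metric_dist_null)
  then show ?thesis
    unfolding mcomplete_def MCauchy_def image_subset_iff by (simp add: Bex_def)
qed

text \<open>The assumption makes \<open>hdist\<close> an instance of the library's metric locale, so
  that \<open>mcomplete\<close> can be unfolded. It is read from right to left for
  \<open>cvec_space\<close> and from left to right for the direct sum.\<close>

lemma complete_space_iff:
  assumes "Metric_space (carrier H) (hdist H)"
  shows "complete_space H \<longleftrightarrow> hilbert_space H"
proof
  assume "complete_space H"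
  then interpret complete_space H .
  have "Metric_space.mcomplete (carrier H) (hdist H)"
    using cauchy_converges by (auto simp: Metric_space.mcomplete_iff_sequential[OF assms] cauchy_seq_def)
  then show "hilbert_space H"
    by unfold_locales (assumption | erule hinner_add_left hinner_smult_left hinner_commute hinner_pos)+
next
  assume "hilbert_space H"
  then interpret hilbert_space H .
  interpret pre_hilbert_space H using \<open>hilbert_space H\<close> by (rule hilbert_space_imp_pre)
  show "complete_space H"
    using complete
    by unfold_locales (auto simp: Metric_space.mcomplete_iff_sequential[OF assms] cauchy_seq_def)
qed

text \<open>\<open>rho\<close> is a classifying map: its fibres are the classes modulo null
  families, and its values may lie in any type. The two instances are Cauchy sequences with the
  limit of inner products (completion) and finite families with the sum of inner products (direct
  sum).\<close>

locale hilbert_quotient = pre_hilbert_space H for H :: "'a hilbert" +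
  fixes S :: "('j \<Rightarrow> 'a) set" and ip :: "('j \<Rightarrow> 'a) \<Rightarrow> ('j \<Rightarrow> 'a) \<Rightarrow> complex"
    and rho :: "('j \<Rightarrow> 'a) \<Rightarrow> 'b"
  assumes S_carrier [simp]: "s \<in> S \<Longrightarrow> s j \<in> carrier H"
    and zero_S [simp]: "(\<lambda>_. \<zero>\<^bsub>H\<^esub>) \<in> S"
    and add_S [simp]: "\<lbrakk>s \<in> S; t \<in> S\<rbrakk> \<Longrightarrow> (\<lambda>j. s j \<oplus>\<^bsub>H\<^esub> t j) \<in> S"
    and smult_S [simp]: "s \<in> S \<Longrightarrow> (\<lambda>j. c \<odot>\<^bsub>H\<^esub> s j) \<in> S"
    and ip_add [simp]: "\<lbrakk>s \<in> S; t \<in> S; u \<in> S\<rbrakk> \<Longrightarrow> ip (\<lambda>j. s j \<oplus>\<^bsub>H\<^esub> t j) u = ip s u + ip t u"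
    and ip_smult [simp]: "\<lbrakk>s \<in> S; u \<in> S\<rbrakk> \<Longrightarrow> ip (\<lambda>j. c \<odot>\<^bsub>H\<^esub> s j) u = c * ip s u"
    and ip_commute: "\<lbrakk>s \<in> S; t \<in> S\<rbrakk> \<Longrightarrow> ip s t = cnj (ip t s)"
    and ip_nonneg: "s \<in> S \<Longrightarrow> Re (ip s s) \<ge> 0"
    and rho_eq_iff: "\<lbrakk>s \<in> S; t \<in> S\<rbrakk> \<Longrightarrow> rho s = rho t \<longleftrightarrow> (\<forall>u\<in>S. ip s u = ip t u)"
begin

text \<open>
  Outside \<open>rho ` S\<close> the section takes the value zero, so that the operations below factor through
  a retraction onto the carrier. This makes \<open>hdist\<close> a metric in the sense of the locale
  \<^locale>\<open>Metric_space\<close>, which demands symmetry and nonnegativity on the whole type.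
\<close>

definition sec :: "'b \<Rightarrow> 'j \<Rightarrow> 'a" where
  "sec b = (if b \<in> rho ` S then SOME s. s \<in> S \<and> rho s = b else (\<lambda>_. \<zero>\<^bsub>H\<^esub>))"

definition quot :: "'b hilbert" where
  "quot = \<lparr>carrier = rho ` S, mult = (\<lambda>a _. a), one = rho (\<lambda>_. \<zero>\<^bsub>H\<^esub>), zero = rho (\<lambda>_. \<zero>\<^bsub>H\<^esub>),
     add = (\<lambda>a b. rho (\<lambda>j. sec a j \<oplus>\<^bsub>H\<^esub> sec b j)),
     smult = (\<lambda>c a. rho (\<lambda>j. c \<odot>\<^bsub>H\<^esub> sec a j)),
     hinner = (\<lambda>a b. ip (sec a) (sec b))\<rparr>"

lemma sec: "b \<in> rho ` S \<Longrightarrow> sec b \<in> S \<and> rho (sec b) = b"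
proof -
  assume "b \<in> rho ` S"
  then have "\<exists>s. s \<in> S \<and> rho s = b" by auto
  from someI_ex[OF this] show ?thesis using \<open>b \<in> rho ` S\<close> by (simp only: sec_def if_True)
qed

lemma sec_S [simp]: "sec b \<in> S"
  using sec[of b] by (cases "b \<in> rho ` S") (auto simp: sec_def)

text \<open>If s has length zero, moving u along s changes the square length of u only linearly, and
  a linear function bounded below is constant.\<close>

lemma ip_null:
  assumes "Re (ip s s) \<le> 0" "s \<in> S" "u \<in> S"
  shows "ip s u = 0"
proof (rule ccontr)
  assume *: "ip s u \<noteq> 0"
  have 0: "ip s s = 0"
    using assms ip_nonneg[of s] ip_commute[of s s] by (auto simp: complex_eq_iff)
  \<comment> \<open>Chosen so that the cross terms contribute -2 (Re <u,u> + 1), which leaves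
    \<open>?v\<close> with the negative square length - Re <u,u> - 2.\<close>
  define r where "r = (Re (ip u u) + 1) / (cmod (ip s u))\<^sup>2"
  let ?c = "- of_real r * cnj (ip s u)"
  let ?v = "\<lambda>j. u j \<oplus>\<^bsub>H\<^esub> ?c \<odot>\<^bsub>H\<^esub> s j"
  have v: "?v \<in> S" using assms by simp
  have "ip u ?v = cnj (ip ?v u)" "ip s ?v = cnj (ip ?v s)"
    using assms v ip_commute by blast+
  moreover have "ip u s = cnj (ip s u)" using assms ip_commute by blast
  ultimately have "ip ?v ?v = cnj (ip u u) + cnj (?c * ip s u) + ?c * ip s u"
    using assms v 0 by simp
  also have "?c * ip s u = - of_real (r * (cmod (ip s u))\<^sup>2)"
    using complex_norm_square[of "ip s u"] by (simp add: mult.commute)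
  also have "r * (cmod (ip s u))\<^sup>2 = Re (ip u u) + 1"
    using * by (simp add: r_def)
  finally have "Re (ip ?v ?v) = - Re (ip u u) - 2" by simp
  then show False using ip_nonneg[OF v] ip_nonneg[OF assms(3)] by linarith
qed

lemma rho_congs:
  assumes "s \<in> S" "s' \<in> S" "rho s = rho s'"
  shows ip_cong_left: "u \<in> S \<Longrightarrow> ip s u = ip s' u"
    and ip_cong_right: "u \<in> S \<Longrightarrow> ip u s = ip u s'"
    and rho_add_cong: "\<lbrakk>t \<in> S; t' \<in> S; rho t = rho t'\<rbrakk> \<Longrightarrow>
      rho (\<lambda>j. s j \<oplus>\<^bsub>H\<^esub> t j) = rho (\<lambda>j. s' j \<oplus>\<^bsub>H\<^esub> t' j)"
    and rho_smult_cong: "rho (\<lambda>j. c \<odot>\<^bsub>H\<^esub> s j) = rho (\<lambda>j. c \<odot>\<^bsub>H\<^esub> s' j)"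
proof -
  show *: "u \<in> S \<Longrightarrow> ip s u = ip s' u" for u using assms by (simp add: rho_eq_iff)
  then show "u \<in> S \<Longrightarrow> ip u s = ip u s'" using assms ip_commute by metis
qed (use assms in \<open>simp_all add: rho_eq_iff\<close>)

lemma quot_simps [simp]:
  "carrier quot = rho ` S" "\<zero>\<^bsub>quot\<^esub> = rho (\<lambda>_. \<zero>\<^bsub>H\<^esub>)"
  by (simp_all add: quot_def)

lemma rho_sec_rho [simp]: "s \<in> S \<Longrightarrow> rho (sec (rho s)) = rho s"
  by (simp add: sec)

lemma quot_add [simp]:
  "\<lbrakk>s \<in> S; t \<in> S\<rbrakk> \<Longrightarrow> rho s \<oplus>\<^bsub>quot\<^esub> rho t = rho (\<lambda>j. s j \<oplus>\<^bsub>H\<^esub> t j)"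
  by (simp add: quot_def, rule rho_add_cong) (simp_all add: sec)

lemma quot_smult [simp]: "s \<in> S \<Longrightarrow> c \<odot>\<^bsub>quot\<^esub> rho s = rho (\<lambda>j. c \<odot>\<^bsub>H\<^esub> s j)"
  by (simp add: quot_def, rule rho_smult_cong) (simp_all add: sec)

lemma quot_hinner [simp]: "\<lbrakk>s \<in> S; t \<in> S\<rbrakk> \<Longrightarrow> hinner quot (rho s) (rho t) = ip s t"
  using ip_cong_left[of "sec (rho s)" s t] ip_cong_right[of "sec (rho t)" t "sec (rho s)"]
  by (simp add: quot_def)

lemma abelian_group_quot: "abelian_group quot"
proof (rule abelian_groupI)
  fix x assume "x \<in> carrier quot"
  then obtain s where s: "s \<in> S" "x = rho s" by auto
  have "(\<lambda>j. (-1) \<odot>\<^bsub>H\<^esub> s j \<oplus>\<^bsub>H\<^esub> s j) = (\<lambda>_. \<zero>\<^bsub>H\<^esub>)"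
  proof
    show "(-1) \<odot>\<^bsub>H\<^esub> s j \<oplus>\<^bsub>H\<^esub> s j = \<zero>\<^bsub>H\<^esub>" for j
      by (rule hinner_eqI) (use s in \<open>auto simp: hinner_simps\<close>)
  qed
  with s show "\<exists>y\<in>carrier quot. y \<oplus>\<^bsub>quot\<^esub> x = \<zero>\<^bsub>quot\<^esub>"
    by (intro bexI[of _ "rho (\<lambda>j. (-1) \<odot>\<^bsub>H\<^esub> s j)"]) auto
qed (auto simp: M.a_ac)

lemma quot_pre_hilbert: "pre_hilbert_space quot"
proof -
  have "Module.module complex_field quot"
    by (rule moduleI[OF R.is_cring abelian_group_quot])
       (auto simp: smult_l_distr[simplified] smult_r_distr[simplified] smult_assoc1[simplified]
         smult_one[simplified])
  \<comment> \<open>Definiteness is the one axiom that does not transfer termwise: by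
    \<open>ip_null\<close> a class of length zero pairs to zero with everything, hence is the class
    of the zero family.\<close>
  moreover have "Re (hinner quot x x) > 0" if "x \<in> carrier quot" "x \<noteq> \<zero>\<^bsub>quot\<^esub>" for x
  proof (rule ccontr)
    assume *: "\<not> Re (hinner quot x x) > 0"
    from that obtain s where s: "s \<in> S" "x = rho s" by auto
    have "ip s u = 0" if "u \<in> S" for u using ip_null[of s u] that s * by simp
    moreover have "ip (\<lambda>_. \<zero>\<^bsub>H\<^esub>) u = 0" if "u \<in> S" for u
      using that ip_add[of "\<lambda>_. \<zero>\<^bsub>H\<^esub>" "\<lambda>_. \<zero>\<^bsub>H\<^esub>" u] by simp
    ultimately have "x = \<zero>\<^bsub>quot\<^esub>" using s by (simp add: rho_eq_iff)
    then show False using that by simp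
  qed
  ultimately show ?thesis
    by (intro pre_hilbert_space.intro pre_hilbert_space_axioms.intro) (auto intro: ip_commute)
qed

sublocale Q: pre_hilbert_space quot by (rule quot_pre_hilbert)

lemma quot_hnorm: "s \<in> S \<Longrightarrow> hnorm quot (rho s) = sqrt (Re (ip s s))"
  by (simp add: hnorm_def)

lemma diff_S [simp]: "\<lbrakk>s \<in> S; t \<in> S\<rbrakk> \<Longrightarrow> (\<lambda>j. s j \<ominus>\<^bsub>H\<^esub> t j) \<in> S"
  by (simp add: minus_eq_smult)

lemma quot_minus [simp]:
  "\<lbrakk>s \<in> S; t \<in> S\<rbrakk> \<Longrightarrow> rho s \<ominus>\<^bsub>quot\<^esub> rho t = rho (\<lambda>j. s j \<ominus>\<^bsub>H\<^esub> t j)"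
  by (simp add: minus_eq_smult Q.minus_eq_smult)

lemma metric_space_quot: "Metric_space (carrier quot) (hdist quot)"
proof -
  \<comment> \<open>\<open>?r\<close> is the retraction onto the carrier. Addition factors through
    it by definition of \<open>quot\<close>. The additive inverse is a definite description in terms
    of sums with b, so it factors as well, and with it \<open>hdist\<close> on the whole
    type.\<close>
  let ?r = "\<lambda>b. rho (sec b)"
  have add_r: "a \<oplus>\<^bsub>quot\<^esub> b = ?r a \<oplus>\<^bsub>quot\<^esub> ?r b" for a b
    by (simp add: quot_def, rule rho_add_cong) (simp_all add: sec)
  have l: "b \<oplus>\<^bsub>quot\<^esub> y = ?r b \<oplus>\<^bsub>quot\<^esub> y" and r: "y \<oplus>\<^bsub>quot\<^esub> b = y \<oplus>\<^bsub>quot\<^esub> ?r b" for b y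
    by (metis add_r rho_sec_rho sec_S)+
  have "\<ominus>\<^bsub>quot\<^esub> b = \<ominus>\<^bsub>quot\<^esub> ?r b" for b
    unfolding a_inv_def m_inv_def using l[of b] r[of _ b] by (auto intro!: arg_cong[of _ _ The])
  then have *: "hdist quot a b = hdist quot (?r a) (?r b)" for a b
    unfolding hdist_def a_minus_def using l[of a] by metis
  have r: "?r b \<in> carrier quot" for b by simp
  show ?thesis
  proof
    show "0 \<le> hdist quot a b" for a b
      unfolding *[of a b] unfolding hdist_def by (rule Q.hnorm_nonneg) (intro Q.M.minus_closed r)
    show "hdist quot a b = hdist quot b a" for a b
      unfolding *[of a b] *[of b a] by (intro Q.hdist_commute r)
    show "hdist quot a b = 0 \<longleftrightarrow> a = b" if "a \<in> carrier quot" "b \<in> carrier quot" for a b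
      unfolding hdist_def Q.hnorm_eq_0[OF Q.M.minus_closed[OF that]] by (rule Q.minus_eq_zero_iff[OF that])
  qed (rule Q.hdist_triangle)
qed

definition lift :: "('j \<Rightarrow> 'a \<Rightarrow> 'a) \<Rightarrow> 'b \<Rightarrow> 'b" where
  "lift D b = rho (\<lambda>j. D j (sec b j))"

context
  fixes D :: "'j \<Rightarrow> 'a \<Rightarrow> 'a" and c :: real
  assumes lin: "\<And>j. linear_op H H (D j)"
    and closed: "\<And>s. s \<in> S \<Longrightarrow> (\<lambda>j. D j (s j)) \<in> S"
    and bound: "\<And>s. s \<in> S \<Longrightarrow> Re (ip (\<lambda>j. D j (s j)) (\<lambda>j. D j (s j))) \<le> c\<^sup>2 * Re (ip s s)"
    and c: "c \<ge> 0"
begin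

text \<open>Independence of the representative: the difference \<open>?u\<close> of two
  representatives is a null family, \<open>bound\<close> makes its image a null family, and
  \<open>ip_null\<close> then shows that the two images pair equally with everything.\<close>

lemma lift_rho: 
  assumes s: "s \<in> S"
  shows "lift D (rho s) = rho (\<lambda>j. D j (s j))"
proof -
  let ?t = "sec (rho s)"
  let ?u = "\<lambda>j. ?t j \<oplus>\<^bsub>H\<^esub> (-1) \<odot>\<^bsub>H\<^esub> s j"
  have u: "?u \<in> S" using s by simp
  have Du: "(\<lambda>j. D j (?u j)) = (\<lambda>j. D j (?t j) \<oplus>\<^bsub>H\<^esub> (-1) \<odot>\<^bsub>H\<^esub> D j (s j))"
    using lin s by (simp add: linear_op_def)
  have "ip ?u ?u = 0"
    using s u ip_cong_left[of ?t s ?u] by simp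
  with bound[OF u] have le: "Re (ip (\<lambda>j. D j (?u j)) (\<lambda>j. D j (?u j))) \<le> 0" by simp
  have "ip (\<lambda>j. D j (?t j)) v = ip (\<lambda>j. D j (s j)) v" if "v \<in> S" for v
    using ip_null[OF le closed[OF u] that] unfolding Du using that s closed by simp
  then show ?thesis using s closed by (simp add: lift_def rho_eq_iff)
qed

lemma lift_linear_op: "linear_op quot quot (lift D)"
  unfolding linear_op_def using lin closed by (auto simp: lift_rho linear_op_def)

lemma lift_hnorm: "b \<in> carrier quot \<Longrightarrow> hnorm quot (lift D b) \<le> c * hnorm quot b"
proof -
  assume "b \<in> carrier quot"
  then obtain s where s: "s \<in> S" "b = rho s" by auto
  have "sqrt (Re (ip (\<lambda>j. D j (s j)) (\<lambda>j. D j (s j)))) \<le> sqrt (c\<^sup>2 * Re (ip s s))"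
    using bound[OF s(1)] by (rule real_sqrt_le_mono)
  also have "\<dots> = c * sqrt (Re (ip s s))" using c by (simp add: real_sqrt_mult)
  finally show ?thesis using s closed by (simp add: lift_rho quot_hnorm)
qed

end

end

section \<open>Completion\<close>

context pre_hilbert_space
begin

lemma linear_op_minus:
  assumes "linear_op H H D" "x \<in> carrier H" "y \<in> carrier H"
  shows "D (x \<ominus>\<^bsub>H\<^esub> y) = D x \<ominus>\<^bsub>H\<^esub> D y"
  using assms by (simp add: minus_eq_smult linear_op_def Pi_iff)

lemma cauchy_seq_carrier [simp]: "cauchy_seq s \<Longrightarrow> s n \<in> carrier H"
  by (simp add: cauchy_seq_def)

lemma cauchy_seq_const: "x \<in> carrier H \<Longrightarrow> cauchy_seq (\<lambda>_. x)"
  using minus_eq_zero_iff[of x x] by (auto simp: cauchy_seq_def hdist_def)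

lemma cauchy_seq_add:
  assumes "cauchy_seq s" "cauchy_seq t"
  shows "cauchy_seq (\<lambda>n. s n \<oplus>\<^bsub>H\<^esub> t n)"
  unfolding cauchy_seq_def
proof (intro conjI allI impI)
  fix e :: real assume "e > 0"
  then have "e/2 > 0" by simp
  from assms this obtain M N where M: "\<And>m n. \<lbrakk>m \<ge> M; n \<ge> M\<rbrakk> \<Longrightarrow> hdist H (s m) (s n) < e/2"
    and N: "\<And>m n. \<lbrakk>m \<ge> N; n \<ge> N\<rbrakk> \<Longrightarrow> hdist H (t m) (t n) < e/2"
    unfolding cauchy_seq_def by metis
  have "hdist H (s m \<oplus>\<^bsub>H\<^esub> t m) (s n \<oplus>\<^bsub>H\<^esub> t n) \<le> hdist H (s m) (s n) + hdist H (t m) (t n)" for m n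
  proof -
    have "(s m \<oplus>\<^bsub>H\<^esub> t m) \<ominus>\<^bsub>H\<^esub> (s n \<oplus>\<^bsub>H\<^esub> t n) = (s m \<ominus>\<^bsub>H\<^esub> s n) \<oplus>\<^bsub>H\<^esub> (t m \<ominus>\<^bsub>H\<^esub> t n)"
      by (rule hinner_eqI) (use assms in \<open>auto simp: hinner_simps\<close>)
    then show ?thesis using assms by (simp add: hdist_def hnorm_triangle)
  qed
  then show "\<exists>K. \<forall>m\<ge>K. \<forall>n\<ge>K. hdist H (s m \<oplus>\<^bsub>H\<^esub> t m) (s n \<oplus>\<^bsub>H\<^esub> t n) < e"
    using M N by (intro exI[of _ "max M N"] allI impI) (smt (verit) max.bounded_iff field_sum_of_halves)
qed (use assms in simp)

lemma cauchy_seq_image: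
  assumes "cauchy_seq s" "linear_op H H D" "\<And>x. x \<in> carrier H \<Longrightarrow> hnorm H (D x) \<le> b * hnorm H x"
  shows "cauchy_seq (\<lambda>n. D (s n))"
  unfolding cauchy_seq_def
proof (intro conjI allI impI)
  show "D (s n) \<in> carrier H" for n
    using assms by (auto simp: linear_op_def)
  fix e :: real assume "e > 0"
  \<comment> \<open>The constant \<open>b\<close> may be zero or negative; the divisor is positive
    in every case.\<close>
  then have "e / (\<bar>b\<bar> + 1) > 0" by (simp add: add_nonneg_pos)
  with assms(1) obtain N where N: "\<And>m n. \<lbrakk>m \<ge> N; n \<ge> N\<rbrakk> \<Longrightarrow> hdist H (s m) (s n) < e / (\<bar>b\<bar> + 1)"
    unfolding cauchy_seq_def by metis
  have "hdist H (D (s m)) (D (s n)) < e" if "m \<ge> N" "n \<ge> N" for m n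
  proof -
    have d: "s m \<ominus>\<^bsub>H\<^esub> s n \<in> carrier H" using assms by simp
    have "hdist H (D (s m)) (D (s n)) = hnorm H (D (s m \<ominus>\<^bsub>H\<^esub> s n))"
      using assms by (simp add: hdist_def linear_op_minus)
    also have "\<dots> \<le> b * hdist H (s m) (s n)" using assms(3)[OF d] by (simp add: hdist_def)
    also have "\<dots> \<le> (\<bar>b\<bar> + 1) * hdist H (s m) (s n)"
      using d by (intro mult_right_mono) (auto simp: hdist_def)
    also have "\<dots> < e" using N[OF that] by (simp add: pos_less_divide_eq add_nonneg_pos mult.commute)
    finally show ?thesis .
  qed
  then show "\<exists>N. \<forall>m\<ge>N. \<forall>n\<ge>N. hdist H (D (s m)) (D (s n)) < e" by blast
qed

lemma linear_op_smult: "linear_op H H (\<lambda>x. c \<odot>\<^bsub>H\<^esub> x)"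
  unfolding linear_op_def
  by (auto simp: smult_r_distr[simplified] smult_assoc1[simplified, symmetric] mult.commute)

lemma cauchy_seq_smult:
  assumes "cauchy_seq s"
  shows "cauchy_seq (\<lambda>n. c \<odot>\<^bsub>H\<^esub> s n)"
  by (rule cauchy_seq_image[OF assms linear_op_smult, of _ "cmod c"]) simp

lemma cauchy_seq_eventually_bounded:
  assumes "cauchy_seq s"
  shows "\<exists>B>0. \<exists>N. \<forall>n\<ge>N. hnorm H (s n) \<le> B"
proof -
  obtain N where N: "\<And>n. n \<ge> N \<Longrightarrow> hdist H (s n) (s N) < 1"
    using assms unfolding cauchy_seq_def by (metis le_refl zero_less_one)
  have "hnorm H (s n) \<le> hnorm H (s N) + 1" if "n \<ge> N" for n
  proof -
    have "s n = (s n \<ominus>\<^bsub>H\<^esub> s N) \<oplus>\<^bsub>H\<^esub> s N"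
      by (rule hinner_eqI) (use assms in \<open>auto simp: hinner_simps\<close>)
    then have "hnorm H (s n) \<le> hdist H (s n) (s N) + hnorm H (s N)"
      unfolding hdist_def using assms hnorm_triangle by (metis M.minus_closed cauchy_seq_carrier)
    then show ?thesis using N[OF that] by simp
  qed
  moreover have "hnorm H (s N) + 1 > 0" using assms by (simp add: add_nonneg_pos)
  ultimately show ?thesis by blast
qed

definition seq_inner :: "(nat \<Rightarrow> 'a) \<Rightarrow> (nat \<Rightarrow> 'a) \<Rightarrow> complex" where
  "seq_inner s t = lim (\<lambda>n. hinner H (s n) (t n))"

text \<open>The scalars form a Cauchy sequence because <s_m,t_m> - <s_n,t_n> = <s_m - s_n, t_m> +
  <s_n, t_m - t_n>, where Cauchy-Schwarz and the eventual bounds on both sequences apply.\<close>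

lemma tendsto_seq_inner:
  assumes s: "cauchy_seq s" and t: "cauchy_seq t"
  shows "(\<lambda>n. hinner H (s n) (t n)) \<longlonglongrightarrow> seq_inner s t"
proof -
  obtain B M where B: "B > 0" "\<And>n. n \<ge> M \<Longrightarrow> hnorm H (s n) \<le> B"
    using cauchy_seq_eventually_bounded[OF s] by blast
  obtain C N where C: "C > 0" "\<And>n. n \<ge> N \<Longrightarrow> hnorm H (t n) \<le> C"
    using cauchy_seq_eventually_bounded[OF t] by blast
  have "Cauchy (\<lambda>n. hinner H (s n) (t n))"
  proof (rule CauchyI)
    fix e :: real assume e: "e > 0"
    then have "e / (2 * C) > 0" "e / (2 * B) > 0" using B C by auto
    with s t obtain K L where K: "\<And>m n. \<lbrakk>m \<ge> K; n \<ge> K\<rbrakk> \<Longrightarrow> hdist H (s m) (s n) < e / (2 * C)"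
      and L: "\<And>m n. \<lbrakk>m \<ge> L; n \<ge> L\<rbrakk> \<Longrightarrow> hdist H (t m) (t n) < e / (2 * B)"
      unfolding cauchy_seq_def by metis
    have "norm (hinner H (s m) (t m) - hinner H (s n) (t n)) < e"
      if mn: "m \<ge> max (max M N) (max K L)" "n \<ge> max (max M N) (max K L)" for m n
    proof -
      let ?x = "s m \<ominus>\<^bsub>H\<^esub> s n" and ?y = "t m \<ominus>\<^bsub>H\<^esub> t n"
      have xy: "?x \<in> carrier H" "?y \<in> carrier H" using s t by auto
      have "hinner H (s m) (t m) - hinner H (s n) (t n) = hinner H ?x (t m) + hinner H (s n) ?y"
        using s t by (simp add: hinner_simps)
      then have "norm (hinner H (s m) (t m) - hinner H (s n) (t n))
          \<le> cmod (hinner H ?x (t m)) + cmod (hinner H (s n) ?y)"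
        by (simp add: norm_triangle_ineq)
      also have "\<dots> \<le> hnorm H ?x * hnorm H (t m) + hnorm H (s n) * hnorm H ?y"
        using s t xy by (intro add_mono cauchy_schwarz) auto
      also have "\<dots> \<le> hnorm H ?x * C + B * hnorm H ?y"
        using B(2)[of n] C(2)[of m] mn xy by (intro add_mono mult_left_mono mult_right_mono) auto
      also have "\<dots> < e / (2 * C) * C + B * (e / (2 * B))"
        using K[of m n] L[of m n] mn B C
        by (intro add_strict_mono mult_strict_right_mono mult_strict_left_mono) (auto simp: hdist_def)
      also have "\<dots> = e" using B C by simp
      finally show ?thesis .
    qed
    then show "\<exists>M. \<forall>m\<ge>M. \<forall>n\<ge>M. norm (hinner H (s m) (t m) - hinner H (s n) (t n)) < e" by blast
  qed
  then show ?thesis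
    unfolding seq_inner_def using Cauchy_convergent convergent_LIMSEQ_iff by blast
qed

lemma seq_inner_eqI: "\<lbrakk>cauchy_seq s; cauchy_seq t; (\<lambda>n. hinner H (s n) (t n)) \<longlonglongrightarrow> l\<rbrakk> \<Longrightarrow> seq_inner s t = l"
  using tendsto_seq_inner LIMSEQ_unique by blast

text \<open>The chosen predicate depends only on the class of \<open>s\<close>, so equivalent
  sequences receive the same representative. The completion therefore has sequences as elements, not
  sets of sequences.\<close>

definition seq_rep :: "(nat \<Rightarrow> 'a) \<Rightarrow> nat \<Rightarrow> 'a" where
  "seq_rep s = (SOME t. cauchy_seq t \<and> (\<forall>u. cauchy_seq u \<longrightarrow> seq_inner t u = seq_inner s u))"

lemma hilbert_quotient_completion: "hilbert_quotient H (Collect cauchy_seq) seq_inner seq_rep"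
proof
  fix s t u c
  assume "s \<in> Collect cauchy_seq" "t \<in> Collect cauchy_seq" 
  then have s: "cauchy_seq s" and t: "cauchy_seq t" by auto
  show "seq_inner s t = cnj (seq_inner t s)"
  proof (rule seq_inner_eqI[OF s t])
    have "(\<lambda>n. cnj (hinner H (t n) (s n))) \<longlonglongrightarrow> cnj (seq_inner t s)"
      by (intro tendsto_cnj tendsto_seq_inner s t)
    then show "(\<lambda>n. hinner H (s n) (t n)) \<longlonglongrightarrow> cnj (seq_inner t s)"
      using s t by (subst hinner_commute) auto
  qed
  have rep: "cauchy_seq (seq_rep s)" "cauchy_seq u \<Longrightarrow> seq_inner (seq_rep s) u = seq_inner s u" if "cauchy_seq s" for s u
  proof -
    have "\<exists>t. cauchy_seq t \<and> (\<forall>u. cauchy_seq u \<longrightarrow> seq_inner t u = seq_inner s u)" using that by blast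
    from someI_ex[OF this] show "cauchy_seq (seq_rep s)" "cauchy_seq u \<Longrightarrow> seq_inner (seq_rep s) u = seq_inner s u"
      unfolding seq_rep_def by blast+
  qed
  show "seq_rep s = seq_rep t \<longleftrightarrow> (\<forall>u\<in>Collect cauchy_seq. seq_inner s u = seq_inner t u)"
  proof
    assume "\<forall>u\<in>Collect cauchy_seq. seq_inner s u = seq_inner t u"
    then show "seq_rep s = seq_rep t" unfolding seq_rep_def by (metis mem_Collect_eq)
  qed (metis rep s t mem_Collect_eq)
  assume "u \<in> Collect cauchy_seq"
  then have u: "cauchy_seq u" by simp
  show "seq_inner (\<lambda>j. s j \<oplus>\<^bsub>H\<^esub> t j) u = seq_inner s u + seq_inner t u"
    using tendsto_add[OF tendsto_seq_inner[OF s u] tendsto_seq_inner[OF t u]] s t u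
    by (intro seq_inner_eqI cauchy_seq_add) (simp_all add: hinner_simps)
next
  fix s u c
  assume "s \<in> Collect cauchy_seq" "u \<in> Collect cauchy_seq" 
  then have s: "cauchy_seq s" and u: "cauchy_seq u" by auto
  show "seq_inner (\<lambda>j. c \<odot>\<^bsub>H\<^esub> s j) u = c * seq_inner s u"
    using tendsto_mult_left[OF tendsto_seq_inner[OF s u], of c] s u
    by (intro seq_inner_eqI cauchy_seq_smult) (simp_all add: hinner_simps)
next
  fix s assume "s \<in> Collect cauchy_seq"
  then have s: "cauchy_seq s" by simp
  show "0 \<le> Re (seq_inner s s)"
    using tendsto_Re[OF tendsto_seq_inner[OF s s]]
    by (rule LIMSEQ_le_const) (use s hinner_self_nonneg in auto)
qed (auto intro: cauchy_seq_add cauchy_seq_smult cauchy_seq_const)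

end

text \<open>Operators extend termwise to Cauchy sequences, and the numerical radius bound passes to
  the limit. The extension property is quantified inside the conclusion so that one \<open>G\<close>
  serves all operators of a tuple.\<close>

lemma completion_exists:
  fixes H :: "'a hilbert"
  assumes "pre_hilbert_space H"
  obtains G :: "(nat \<Rightarrow> 'a) hilbert" and J where "complete_space G" "linear_op H G J"
    "\<And>x y. \<lbrakk>x \<in> carrier H; y \<in> carrier H\<rbrakk> \<Longrightarrow> hinner G (J x) (J y) = hinner H x y"
    "\<forall>A. bounded_op H H A \<and> (\<forall>x\<in>carrier H. cmod (hinner H (A x) x) \<le> (hnorm H x)\<^sup>2) \<longrightarrow>
       (\<exists>B. bounded_op G G B \<and> (\<forall>x\<in>carrier G. cmod (hinner G (B x) x) \<le> (hnorm G x)\<^sup>2) \<and>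
         (\<forall>x\<in>carrier H. B (J x) = J (A x)))"
proof -
  interpret pre_hilbert_space H by fact
  interpret C: hilbert_quotient H "Collect cauchy_seq" seq_inner seq_rep by (rule hilbert_quotient_completion)
  let ?G = "C.quot"
  let ?J = "\<lambda>x. seq_rep (\<lambda>_. x)"
  \<comment> \<open>Distances in the completion are limits of termwise distances; density of the
    image of \<open>?J\<close> and completeness both rest on this.\<close>
  have tendsto_dist: "(\<lambda>n. hdist H (s n) (t n)) \<longlonglongrightarrow> hdist ?G (seq_rep s) (seq_rep t)"
    if st: "cauchy_seq s" "cauchy_seq t" for s t
  proof -
    let ?u = "\<lambda>n. s n \<ominus>\<^bsub>H\<^esub> t n"
    have u: "cauchy_seq ?u" using C.diff_S[of s t] st by simp
    have "hdist ?G (seq_rep s) (seq_rep t) = sqrt (Re (seq_inner ?u ?u))"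
      using st u by (simp add: hdist_def C.quot_hnorm)
    moreover have "(\<lambda>n. sqrt (Re (hinner H (?u n) (?u n)))) \<longlonglongrightarrow> sqrt (Re (seq_inner ?u ?u))"
      by (intro tendsto_intros tendsto_seq_inner u)
    ultimately show ?thesis by (simp add: hdist_def hnorm_def)
  qed
  have J: "linear_op H ?G ?J"
    by (auto simp: linear_op_def cauchy_seq_const)
  have J_inner: "hinner ?G (?J x) (?J y) = hinner H x y" if "x \<in> carrier H" "y \<in> carrier H" for x y
    using that by (simp add: cauchy_seq_const seq_inner_eqI)
  have J_dist: "hdist ?G (?J x) (?J y) = hdist H x y" if "x \<in> carrier H" "y \<in> carrier H" for x y
    using tendsto_dist[of "\<lambda>_. x" "\<lambda>_. y"] that by (simp add: cauchy_seq_const LIMSEQ_const_iff)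
  have dense: "\<exists>x\<in>carrier H. hdist ?G b (?J x) < e" if b: "b \<in> carrier ?G" and e: "e > 0" for b e
  proof -
    obtain s where s: "cauchy_seq s" "b = seq_rep s" using b by auto
    have "e/2 > 0" using e by simp
    then obtain N where N: "\<And>m n. \<lbrakk>m \<ge> N; n \<ge> N\<rbrakk> \<Longrightarrow> hdist H (s m) (s n) < e/2"
      using s unfolding cauchy_seq_def by metis
    have "hdist ?G b (?J (s N)) \<le> e/2"
      unfolding s(2)
      by (rule LIMSEQ_le_const2[OF tendsto_dist]) (use s N cauchy_seq_const in \<open>auto intro!: exI[of _ N] less_imp_le\<close>)
    then show ?thesis using e s by (intro bexI[of _ "s N"]) auto
  qed
  have "complete_space ?G"
  proof
    fix s assume s: "C.Q.cauchy_seq s"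
    then have sc: "s k \<in> carrier ?G" for k by (rule C.Q.cauchy_seq_carrier)
    \<comment> \<open>Replace each \<open>s k\<close> by a vector \<open>a k\<close> of H at
      distance below 1/(k+1). The sequence \<open>a\<close> is then Cauchy in H, and its class is
      the limit sought.\<close>
    have "\<forall>k. \<exists>x\<in>carrier H. hdist ?G (s k) (?J x) < inverse (real (Suc k))"
      using dense[OF sc] by simp
    then obtain a where a: "a k \<in> carrier H" "hdist ?G (s k) (?J (a k)) < inverse (real (Suc k))" for k
      by metis
    have Ja: "?J (a k) \<in> carrier ?G" for k using a J by (auto simp: linear_op_def)
    have "cauchy_seq a"
      unfolding cauchy_seq_def
    proof (intro conjI allI impI a)
      fix e :: real assume "e > 0"
      then have e: "e/3 > 0" by simp
      with s obtain N where N: "\<And>m n. \<lbrakk>m \<ge> N; n \<ge> N\<rbrakk> \<Longrightarrow> hdist ?G (s m) (s n) < e/3"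
        unfolding C.Q.cauchy_seq_def by metis
      obtain M where M: "inverse (real (Suc M)) < e/3" using reals_Archimedean[OF e] by blast
      have "hdist H (a m) (a n) < e" if mn: "m \<ge> max M N" "n \<ge> max M N" for m n
      proof -
        have *: "hdist ?G (s k) (?J (a k)) < e/3" if "k \<ge> max M N" for k
        proof -
          have "inverse (real (Suc k)) \<le> inverse (real (Suc M))"
            using that by (intro le_imp_inverse_le) auto
          then show ?thesis using a(2)[of k] M by linarith
        qed
        have "hdist H (a m) (a n) = hdist ?G (?J (a m)) (?J (a n))" using a J_dist by simp
        also have "\<dots> \<le> hdist ?G (?J (a m)) (s m) + hdist ?G (s m) (?J (a n))"
          by (intro C.Q.hdist_triangle Ja sc)
        also have "hdist ?G (s m) (?J (a n)) \<le> hdist ?G (s m) (s n) + hdist ?G (s n) (?J (a n))"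
          by (intro C.Q.hdist_triangle Ja sc)
        also have "hdist ?G (?J (a m)) (s m) = hdist ?G (s m) (?J (a m))"
          by (intro C.Q.hdist_commute Ja sc)
        finally show ?thesis using *[OF mn(1)] *[OF mn(2)] N[of m n] mn by simp
      qed
      then show "\<exists>N. \<forall>m\<ge>N. \<forall>n\<ge>N. hdist H (a m) (a n) < e" by blast
    qed
    then have ca: "cauchy_seq a" "seq_rep a \<in> carrier ?G" by auto
    have lim: "(\<lambda>k. hdist ?G (?J (a k)) (seq_rep a)) \<longlonglongrightarrow> 0"
    proof (rule LIMSEQ_I)
      fix e :: real assume "e > 0"
      then have e: "e/2 > 0" by simp
      then obtain N where N: "\<And>m n. \<lbrakk>m \<ge> N; n \<ge> N\<rbrakk> \<Longrightarrow> hdist H (a m) (a n) < e/2"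
        using ca unfolding cauchy_seq_def by metis
      have "norm (hdist ?G (?J (a k)) (seq_rep a) - 0) < e" if k: "k \<ge> N" for k
      proof -
        have "hdist ?G (?J (a k)) (seq_rep a) \<le> e/2"
          by (rule LIMSEQ_le_const2[OF tendsto_dist]) 
             (use N k ca cauchy_seq_const in \<open>auto intro!: exI[of _ N] less_imp_le\<close>)
        moreover have "hdist ?G (?J (a k)) (seq_rep a) \<ge> 0"
          unfolding hdist_def by (intro C.Q.hnorm_nonneg C.Q.M.minus_closed Ja ca)
        ultimately show ?thesis using e by simp
      qed
      then show "\<exists>N. \<forall>k\<ge>N. norm (hdist ?G (?J (a k)) (seq_rep a) - 0) < e" by blast
    qed
    have "(\<lambda>k. hdist ?G (s k) (seq_rep a)) \<longlonglongrightarrow> 0"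
    proof (rule tendsto_sandwich)
      show "\<forall>\<^sub>F k in sequentially. 0 \<le> hdist ?G (s k) (seq_rep a)"
        unfolding hdist_def by (intro always_eventually allI C.Q.hnorm_nonneg C.Q.M.minus_closed sc ca)
      show "\<forall>\<^sub>F k in sequentially. hdist ?G (s k) (seq_rep a)
          \<le> inverse (real (Suc k)) + hdist ?G (?J (a k)) (seq_rep a)"
      proof (intro always_eventually allI)
        fix k
        have "hdist ?G (s k) (seq_rep a) \<le> hdist ?G (s k) (?J (a k)) + hdist ?G (?J (a k)) (seq_rep a)"
          by (intro C.Q.hdist_triangle Ja sc ca)
        then show "hdist ?G (s k) (seq_rep a) \<le> inverse (real (Suc k)) + hdist ?G (?J (a k)) (seq_rep a)"
          using a(2)[of k] by linarith
      qed
      show "(\<lambda>k. inverse (real (Suc k)) + hdist ?G (?J (a k)) (seq_rep a)) \<longlonglongrightarrow> 0"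
        using tendsto_add[OF LIMSEQ_inverse_real_of_nat lim] by simp
    qed simp
    then show "\<exists>x\<in>carrier ?G. (\<lambda>n. hdist ?G (s n) x) \<longlonglongrightarrow> 0" using ca by blast
  qed
  moreover have "\<exists>B. bounded_op ?G ?G B \<and> (\<forall>x\<in>carrier ?G. cmod (hinner ?G (B x) x) \<le> (hnorm ?G x)\<^sup>2) \<and>
         (\<forall>x\<in>carrier H. B (?J x) = ?J (A x))"
    if A: "bounded_op H H A" and num: "\<And>x. x \<in> carrier H \<Longrightarrow> cmod (hinner H (A x) x) \<le> (hnorm H x)\<^sup>2" for A
  proof -
    have lin: "linear_op H H A" using A by (simp add: bounded_op_def)
    obtain b' where b': "\<And>x. x \<in> carrier H \<Longrightarrow> hnorm H (A x) \<le> b' * hnorm H x"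
      using A unfolding bounded_op_def by blast
    \<comment> \<open>The facts about \<open>lift\<close> ask for a nonnegative constant.\<close>
    define b where "b = max b' 0"
    have b: "hnorm H (A x) \<le> b * hnorm H x" if "x \<in> carrier H" for x
      using b'[OF that] mult_right_mono[of b' b "hnorm H x"] that by (simp add: b_def)
    have closed: "cauchy_seq (\<lambda>n. A (s n))" if "cauchy_seq s" for s
      by (rule cauchy_seq_image[OF that lin b])
    have bound: "Re (seq_inner (\<lambda>n. A (s n)) (\<lambda>n. A (s n))) \<le> b\<^sup>2 * Re (seq_inner s s)" if s: "cauchy_seq s" for s
    proof (rule LIMSEQ_le)
      show "(\<lambda>n. Re (hinner H (A (s n)) (A (s n)))) \<longlonglongrightarrow> Re (seq_inner (\<lambda>n. A (s n)) (\<lambda>n. A (s n)))"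
        by (intro tendsto_Re tendsto_seq_inner closed s)
      show "(\<lambda>n. b\<^sup>2 * Re (hinner H (s n) (s n))) \<longlonglongrightarrow> b\<^sup>2 * Re (seq_inner s s)"
        by (intro tendsto_mult_left tendsto_Re tendsto_seq_inner closed s)
      have "Re (hinner H (A (s n)) (A (s n))) \<le> b\<^sup>2 * Re (hinner H (s n) (s n))" for n
      proof -
        have Asn: "A (s n) \<in> carrier H" using cauchy_seq_carrier[OF closed[OF s]] .
        then have "(hnorm H (A (s n)))\<^sup>2 \<le> (b * hnorm H (s n))\<^sup>2"
          using b[of "s n"] s by (intro power_mono) auto
        then show ?thesis using s Asn by (simp add: hnorm_square power_mult_distrib)
      qed
      then show "\<exists>N. \<forall>n\<ge>N. Re (hinner H (A (s n)) (A (s n))) \<le> b\<^sup>2 * Re (hinner H (s n) (s n))" by blast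
    qed
    let ?B = "C.lift (\<lambda>_. A)"
    have "b \<ge> 0" by (simp add: b_def)
    note lift = C.lift_rho[of "\<lambda>_. A" b] C.lift_linear_op[of "\<lambda>_. A" b] C.lift_hnorm[of "\<lambda>_. A" b]
    have B: "?B (seq_rep s) = seq_rep (\<lambda>n. A (s n))" if "cauchy_seq s" for s
      using lift(1) lin closed bound \<open>b \<ge> 0\<close> that by simp
    have "bounded_op ?G ?G ?B"
      unfolding bounded_op_def
      using lift(2,3) lin closed bound \<open>b \<ge> 0\<close> by blast
    moreover have "cmod (hinner ?G (?B x) x) \<le> (hnorm ?G x)\<^sup>2" if x: "x \<in> carrier ?G" for x
    proof -
      obtain s where s: "cauchy_seq s" "x = seq_rep s" using x by auto
      have "cmod (seq_inner (\<lambda>n. A (s n)) s) \<le> Re (seq_inner s s)"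
      proof (rule LIMSEQ_le)
        show "(\<lambda>n. cmod (hinner H (A (s n)) (s n))) \<longlonglongrightarrow> cmod (seq_inner (\<lambda>n. A (s n)) s)"
          by (intro tendsto_norm tendsto_seq_inner closed s)
        show "(\<lambda>n. Re (hinner H (s n) (s n))) \<longlonglongrightarrow> Re (seq_inner s s)"
          by (intro tendsto_Re tendsto_seq_inner s)
        show "\<exists>N. \<forall>n\<ge>N. cmod (hinner H (A (s n)) (s n)) \<le> Re (hinner H (s n) (s n))"
          using num s by (simp flip: hnorm_square)
      qed
      then show ?thesis using s closed by (simp add: B C.Q.hnorm_square)
    qed
    moreover have "?B (?J x) = ?J (A x)" if "x \<in> carrier H" for x
      using B[of "\<lambda>_. x"] that by (simp add: cauchy_seq_const)
    ultimately show ?thesis by blast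
  qed
  ultimately show thesis using that[OF _ J J_inner] by blast
qed

section \<open>Adjoints and the Cartesian decomposition\<close>

context pre_hilbert_space
begin

lemma tendsto_hnorm:
  assumes "\<And>n. s n \<in> carrier H" "x \<in> carrier H" "(\<lambda>n. hdist H (s n) x) \<longlonglongrightarrow> 0"
  shows "(\<lambda>n. hnorm H (s n)) \<longlonglongrightarrow> hnorm H x"
proof (rule LIM_zero_cancel, rule tendsto_rabs_zero_cancel, rule tendsto_sandwich[OF _ _ tendsto_const assms(3)])
  have "\<bar>hnorm H (s n) - hnorm H x\<bar> \<le> hdist H (s n) x" for n
  proof -
    have "s n = (s n \<ominus>\<^bsub>H\<^esub> x) \<oplus>\<^bsub>H\<^esub> x" "x = (x \<ominus>\<^bsub>H\<^esub> s n) \<oplus>\<^bsub>H\<^esub> s n"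
      by (rule hinner_eqI; use assms in \<open>auto simp: hinner_simps\<close>)+
    then have "hnorm H (s n) \<le> hdist H (s n) x + hnorm H x" "hnorm H x \<le> hdist H x (s n) + hnorm H (s n)"
      unfolding hdist_def using assms hnorm_triangle by (metis M.minus_closed)+
    then show ?thesis using hdist_commute[of x "s n"] assms by simp
  qed
  then show "\<forall>\<^sub>F n in sequentially. \<bar>hnorm H (s n) - hnorm H x\<bar> \<le> hdist H (s n) x" by simp
qed simp

text \<open>For self-adjoint R, polarization gives 4 Re <Rx,y> = <R(x+y),x+y> - <R(x-y),x-y>. The
  numerical bound and the parallelogram law estimate this by 2 ||x||^2 + 2 ||y||^2.\<close>

lemma hnorm_le_if_self_adjoint:
  assumes lin: "linear_op H H R"
    and sa: "\<And>x y. \<lbrakk>x \<in> carrier H; y \<in> carrier H\<rbrakk> \<Longrightarrow> hinner H (R x) y = hinner H x (R y)"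
    and num: "\<And>x. x \<in> carrier H \<Longrightarrow> \<bar>Re (hinner H (R x) x)\<bar> \<le> (hnorm H x)\<^sup>2"
    and x: "x \<in> carrier H"
  shows "hnorm H (R x) \<le> hnorm H x"
proof (cases "hnorm H (R x) = 0 \<or> hnorm H x = 0")
  case True
  have "R x = \<zero>\<^bsub>H\<^esub>" if "x = \<zero>\<^bsub>H\<^esub>"
    using linear_op_minus[OF lin x x] lin that x minus_eq_zero_iff[of x x] minus_eq_zero_iff[of "R x" "R x"]
    by (auto simp: linear_op_def)
  then show ?thesis using True x by auto
next
  case False
  have Rx: "R x \<in> carrier H" using lin x by (auto simp: linear_op_def)
  \<comment> \<open>This scaling makes y = t R x as long as x, so that the estimate becomes 4 ||x||
    ||Rx|| \<le> 4 ||x||^2.\<close>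
  define t where "t = hnorm H x / hnorm H (R x)"
  let ?y = "of_real t \<odot>\<^bsub>H\<^esub> R x"
  let ?p = "x \<oplus>\<^bsub>H\<^esub> ?y" and ?m = "x \<ominus>\<^bsub>H\<^esub> ?y"
  have y: "?y \<in> carrier H" using Rx by simp
  have Rpm: "R ?p = R x \<oplus>\<^bsub>H\<^esub> R ?y" "R ?m = R x \<ominus>\<^bsub>H\<^esub> R ?y" "R ?y \<in> carrier H"
    using lin x y linear_op_minus[OF lin x y] by (auto simp: linear_op_def)
  have yx: "hinner H (R ?y) x = hinner H ?y (R x)" using sa y x by blast
  have "4 * t * (hnorm H (R x))\<^sup>2 = Re (hinner H (R ?p) ?p) - Re (hinner H (R ?m) ?m)"
    using x y Rx Rpm by (simp add: hinner_add_left hinner_add_right hinner_diff_left hinner_diff_right yx)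
      (simp add: hinner_simps Rx hinner_self)
  also have "\<dots> \<le> (hnorm H ?p)\<^sup>2 + (hnorm H ?m)\<^sup>2"
    using num[of ?p] num[of ?m] x y by auto
  also have "\<dots> = 2 * (hnorm H x)\<^sup>2 + 2 * (hnorm H ?y)\<^sup>2"
    using x y by (simp add: hnorm_square hinner_add_left hinner_add_right hinner_diff_left hinner_diff_right)
  also have "hnorm H ?y = hnorm H x"
    using Rx False x by (simp add: t_def norm_divide)
  finally have "4 * t * (hnorm H (R x))\<^sup>2 \<le> 4 * (hnorm H x)\<^sup>2" by simp
  then have "hnorm H x * hnorm H (R x) \<le> hnorm H x * hnorm H x"
    using False by (simp add: t_def power2_eq_square)
  moreover have "hnorm H x > 0" using False x by (simp add: order_less_le)
  ultimately show ?thesis by simp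
qed

end

context complete_space
begin

text \<open>Variational proof. If f is represented by y, then \<open>\<phi>\<close> x = ||x - y||^2
  - ||y||^2, so y is sought as a minimizer of \<open>\<phi>\<close>. Minimizing sequences are Cauchy
  by the parallelogram law, and vanishing of the first variation at the minimizer is the
  representation.\<close>

lemma riesz:
  assumes add: "\<And>x y. \<lbrakk>x \<in> carrier H; y \<in> carrier H\<rbrakk> \<Longrightarrow> f (x \<oplus>\<^bsub>H\<^esub> y) = f x + f y"
    and smult: "\<And>c x. x \<in> carrier H \<Longrightarrow> f (c \<odot>\<^bsub>H\<^esub> x) = c * f x"
    and bound: "\<And>x. x \<in> carrier H \<Longrightarrow> cmod (f x) \<le> b * hnorm H x"
  obtains y where "y \<in> carrier H" "\<And>x. x \<in> carrier H \<Longrightarrow> f x = hinner H x y"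
proof -
  define \<phi> where "\<phi> x = (hnorm H x)\<^sup>2 - 2 * Re (f x)" for x
  have f_minus: "f (x \<ominus>\<^bsub>H\<^esub> y) = f x - f y" if "x \<in> carrier H" "y \<in> carrier H" for x y
    using that by (simp add: minus_eq_smult add smult)
  have lower: "- b\<^sup>2 \<le> \<phi> x" if "x \<in> carrier H" for x
  proof -
    have "Re (f x) \<le> b * hnorm H x" using bound[OF that] complex_Re_le_cmod order_trans by blast
    moreover have "0 \<le> (hnorm H x - b)\<^sup>2" by simp
    ultimately show ?thesis by (simp add: \<phi>_def power2_diff mult.commute)
  qed
  define m where "m = (INF x\<in>carrier H. \<phi> x)"
  have bdd: "bdd_below (\<phi> ` carrier H)" using lower by (rule bdd_belowI2)
  have m_le: "m \<le> \<phi> x" if "x \<in> carrier H" for x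
    unfolding m_def by (rule cINF_lower[OF bdd that])
  have "\<exists>x\<in>carrier H. \<phi> x < m + inverse (real (Suc n))" for n
    using cINF_less_iff[of "carrier H" \<phi> "m + inverse (real (Suc n))"] bdd M.zero_closed
    unfolding m_def by (auto simp del: of_nat_Suc)
  then obtain s where s: "\<And>n. s n \<in> carrier H" "\<And>n. \<phi> (s n) < m + inverse (real (Suc n))" by metis
  \<comment> \<open>Parallelogram law at the midpoint \<open>?h\<close>, where \<open>\<phi>\<close>
    is at least \<open>m\<close>; the linear part of \<open>\<phi>\<close> cancels.\<close>
  have par: "(hdist H x y)\<^sup>2 \<le> 2 * (\<phi> x - m) + 2 * (\<phi> y - m)" if "x \<in> carrier H" "y \<in> carrier H" for x y
  proof -
    let ?h = "(1/2) \<odot>\<^bsub>H\<^esub> (x \<oplus>\<^bsub>H\<^esub> y)"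
    have "(hdist H x y)\<^sup>2 = 2 * \<phi> x + 2 * \<phi> y - 4 * \<phi> ?h"
      using that by (simp add: \<phi>_def hdist_def add smult hnorm_square hinner_add_left
          hinner_add_right hinner_diff_left hinner_diff_right power_divide add_divide_distrib)
    then show ?thesis using m_le[of ?h] that by simp
  qed
  have "cauchy_seq s"
    unfolding cauchy_seq_def
  proof (intro conjI allI impI s)
    fix e :: real assume e: "e > 0"
    then have "e\<^sup>2 / 4 > 0" by simp
    then obtain N where N: "inverse (real (Suc N)) < e\<^sup>2 / 4" using reals_Archimedean by blast
    have "hdist H (s k) (s l) < e" if "k \<ge> N" "l \<ge> N" for k l
    proof -
      have *: "\<phi> (s k) - m < e\<^sup>2 / 4" if "k \<ge> N" for k
      proof -
        have "inverse (real (Suc k)) \<le> inverse (real (Suc N))"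
          using that by (intro le_imp_inverse_le) auto
        then show ?thesis using s(2)[of k] N by linarith
      qed
      have "(hdist H (s k) (s l))\<^sup>2 < 4 * (e\<^sup>2 / 4)"
        using par[OF s(1) s(1), of k l] *[OF that(1)] *[OF that(2)] by argo
      then have "(hdist H (s k) (s l))\<^sup>2 < e\<^sup>2" by simp
      then show ?thesis using e by (simp add: power_less_imp_less_base)
    qed
    then show "\<exists>N. \<forall>k\<ge>N. \<forall>l\<ge>N. hdist H (s k) (s l) < e" by blast
  qed
  then obtain y where y: "y \<in> carrier H" and lim: "(\<lambda>n. hdist H (s n) y) \<longlonglongrightarrow> 0"
    using cauchy_converges by blast
  have "(\<lambda>n. f (s n) - f y) \<longlonglongrightarrow> 0"
  proof (rule Lim_null_comparison)
    show "\<forall>\<^sub>F n in sequentially. norm (f (s n) - f y) \<le> b * hdist H (s n) y"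
      using bound[of "s _ \<ominus>\<^bsub>H\<^esub> y"] s(1) y by (simp add: f_minus hdist_def)
    show "(\<lambda>n. b * hdist H (s n) y) \<longlonglongrightarrow> 0" using tendsto_mult_left[OF lim, of b] by simp
  qed
  then have "(\<lambda>n. f (s n)) \<longlonglongrightarrow> f y" by (rule LIM_zero_cancel)
  then have "(\<lambda>n. \<phi> (s n)) \<longlonglongrightarrow> \<phi> y"
    unfolding \<phi>_def by (intro tendsto_intros tendsto_hnorm s y lim)
  moreover have "(\<lambda>n. m + inverse (real (Suc n))) \<longlonglongrightarrow> m"
    using tendsto_add[OF tendsto_const LIMSEQ_inverse_real_of_nat, of m] by simp
  ultimately have "\<phi> y \<le> m"
    using s(2) by (intro LIMSEQ_le) (auto intro: less_imp_le)
  then have y_min: "\<phi> y \<le> \<phi> x" if "x \<in> carrier H" for x using m_le[OF that] by simp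
  have "f z = hinner H z y" if z: "z \<in> carrier H" for z
  proof (rule ccontr)
    define w where "w = hinner H z y - f z"
    assume "f z \<noteq> hinner H z y"
    then have w: "cmod w > 0" by (simp add: w_def)
    define n where "n = (hnorm H z)\<^sup>2"
    \<comment> \<open>A step short enough for the linear decrease to dominate: moving by
      \<open>?c\<close> times z changes \<open>\<phi>\<close> by r |w|^2 (r n - 2), and r n \<le>
      1.\<close>
    define r where "r = inverse (1 + n)"
    have n: "n \<ge> 0" by (simp add: n_def)
    have r: "r > 0" "r * n \<le> 1" using n by (auto simp: r_def field_simps)
    let ?c = "- of_real r * cnj w"
    let ?v = "y \<oplus>\<^bsub>H\<^esub> ?c \<odot>\<^bsub>H\<^esub> z"
    have yz: "hinner H y z = cnj (hinner H z y)" using y z hinner_commute by blast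
    have "hinner H ?v ?v = hinner H y y + (cnj (?c * hinner H z y) + ?c * hinner H z y) + (?c * cnj ?c) * hinner H z z"
      using y z by (simp add: hinner_simps yz algebra_simps)
    then have "(hnorm H ?v)\<^sup>2 = (hnorm H y)\<^sup>2 + 2 * Re (?c * hinner H z y) + Re ((?c * cnj ?c) * hinner H z z)"
      using y z by (simp add: hnorm_square)
    also have "?c * cnj ?c = of_real (r\<^sup>2 * (cmod w)\<^sup>2)"
      using complex_norm_square[of w] by (simp add: power2_eq_square mult_ac)
    finally have "\<phi> ?v = \<phi> y + 2 * Re (?c * w) + r\<^sup>2 * (cmod w)\<^sup>2 * n"
      using y z by (simp add: \<phi>_def add smult n_def hnorm_square w_def algebra_simps)
    also have "?c * w = - of_real (r * (cmod w)\<^sup>2)"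
      using complex_norm_square[of w] by (simp add: mult_ac)
    finally have "\<phi> ?v = \<phi> y + r * (cmod w)\<^sup>2 * (r * n - 2)" by (simp add: power2_eq_square algebra_simps)
    moreover have "r * (cmod w)\<^sup>2 * (r * n - 2) < 0"
      using r w by (intro mult_pos_neg) auto
    ultimately show False using y_min[of ?v] y z by simp
  qed
  then show thesis using that y by blast
qed

text \<open>Riesz applied to x -> <Ax,y> for each y. Linearity of the resulting map follows from
  uniqueness of the representing vector.\<close>

lemma adjoint_exists:
  assumes "bounded_op H H A"
  obtains S where "linear_op H H S"
    "\<And>x y. \<lbrakk>x \<in> carrier H; y \<in> carrier H\<rbrakk> \<Longrightarrow> hinner H (A x) y = hinner H x (S y)"
proof -
  have lin: "linear_op H H A" using assms by (simp add: bounded_op_def)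
  have A: "A x \<in> carrier H" if "x \<in> carrier H" for x using lin that by (auto simp: linear_op_def)
  obtain b where b: "\<And>x. x \<in> carrier H \<Longrightarrow> hnorm H (A x) \<le> b * hnorm H x"
    using assms unfolding bounded_op_def by blast
  have "\<exists>w\<in>carrier H. \<forall>x\<in>carrier H. hinner H (A x) y = hinner H x w" if y: "y \<in> carrier H" for y
  proof (rule riesz[of "\<lambda>x. hinner H (A x) y" "b * hnorm H y"])
    show "cmod (hinner H (A x) y) \<le> b * hnorm H y * hnorm H x" if "x \<in> carrier H" for x
    proof -
      have "cmod (hinner H (A x) y) \<le> hnorm H (A x) * hnorm H y" using A that y by (intro cauchy_schwarz)
      also have "\<dots> \<le> b * hnorm H x * hnorm H y" using b that y by (intro mult_right_mono) auto
      finally show ?thesis by (simp add: mult_ac)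
    qed
  qed (use y A lin in \<open>auto simp: linear_op_def hinner_simps\<close>)
  then obtain S where S: "S y \<in> carrier H" "x \<in> carrier H \<Longrightarrow> hinner H (A x) y = hinner H x (S y)"
    if "y \<in> carrier H" for x y by metis
  have "linear_op H H S"
    unfolding linear_op_def
  proof (intro conjI ballI allI)
    fix x y assume xy: "x \<in> carrier H" "y \<in> carrier H"
    show "S (x \<oplus>\<^bsub>H\<^esub> y) = S x \<oplus>\<^bsub>H\<^esub> S y"
      by (rule hinner_eqI) (use xy A in \<open>auto simp: S(1) hinner_add_right simp flip: S(2)\<close>)
  next
    fix c x assume x: "x \<in> carrier H"
    show "S (c \<odot>\<^bsub>H\<^esub> x) = c \<odot>\<^bsub>H\<^esub> S x"
      by (rule hinner_eqI) (use x A in \<open>auto simp: S(1) hinner_smult_right simp flip: S(2)\<close>)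
  qed (use S in auto)
  then show thesis using that S by blast
qed

text \<open>
  The summand \<open>M\<close> is \<open>i\<close> times the imaginary part of \<open>A\<close>. Both parts are contractions although
  \<open>A\<close> itself, of which only the numerical radius is controlled, need not be one.
\<close>

lemma cartesian_decomposition:
  assumes A: "bounded_op H H A"
    and num: "\<And>x. x \<in> carrier H \<Longrightarrow> cmod (hinner H (A x) x) \<le> (hnorm H x)\<^sup>2"
  obtains R M where "linear_op H H R" "linear_op H H M"
    "\<And>x y. \<lbrakk>x \<in> carrier H; y \<in> carrier H\<rbrakk> \<Longrightarrow> hinner H (R x) y = hinner H x (R y)"
    "\<And>x y. \<lbrakk>x \<in> carrier H; y \<in> carrier H\<rbrakk> \<Longrightarrow> hinner H (M x) y = - hinner H x (M y)"
    "\<And>x. x \<in> carrier H \<Longrightarrow> hnorm H (R x) \<le> hnorm H x"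
    "\<And>x. x \<in> carrier H \<Longrightarrow> hnorm H (M x) \<le> hnorm H x"
    "\<And>x. x \<in> carrier H \<Longrightarrow> R x \<oplus>\<^bsub>H\<^esub> M x = A x"
proof -
  obtain S where S: "linear_op H H S"
    "\<And>x y. \<lbrakk>x \<in> carrier H; y \<in> carrier H\<rbrakk> \<Longrightarrow> hinner H (A x) y = hinner H x (S y)"
    using adjoint_exists[OF A] by blast
  have lin: "linear_op H H A" using A by (simp add: bounded_op_def)
  have cl [simp]: "A x \<in> carrier H" "S x \<in> carrier H" if "x \<in> carrier H" for x
    using lin S(1) that by (auto simp: linear_op_def)
  have S': "hinner H (S x) y = hinner H x (A y)" if "x \<in> carrier H" "y \<in> carrier H" for x y
    using that S(2)[of y x] hinner_commute[of "S x" y] hinner_commute[of x "A y"] by simp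
  let ?R = "\<lambda>x. (1/2) \<odot>\<^bsub>H\<^esub> (A x \<oplus>\<^bsub>H\<^esub> S x)" and ?M = "\<lambda>x. (1/2) \<odot>\<^bsub>H\<^esub> (A x \<ominus>\<^bsub>H\<^esub> S x)"
  \<comment> \<open>The maps \<open>?R\<close>, \<open>?M\<close> and \<open>?iM\<close> all agree
    on the carrier with such combinations, so linearity is checked only once.\<close>
  have comb: "linear_op H H (\<lambda>x. c \<odot>\<^bsub>H\<^esub> A x \<oplus>\<^bsub>H\<^esub> d \<odot>\<^bsub>H\<^esub> S x)" for c d
    unfolding linear_op_def
  proof (intro conjI ballI allI)
    fix x y assume "x \<in> carrier H" "y \<in> carrier H"
    then show "c \<odot>\<^bsub>H\<^esub> A (x \<oplus>\<^bsub>H\<^esub> y) \<oplus>\<^bsub>H\<^esub> d \<odot>\<^bsub>H\<^esub> S (x \<oplus>\<^bsub>H\<^esub> y) =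
        (c \<odot>\<^bsub>H\<^esub> A x \<oplus>\<^bsub>H\<^esub> d \<odot>\<^bsub>H\<^esub> S x) \<oplus>\<^bsub>H\<^esub> (c \<odot>\<^bsub>H\<^esub> A y \<oplus>\<^bsub>H\<^esub> d \<odot>\<^bsub>H\<^esub> S y)"
      using lin S(1) by (intro hinner_eqI) (auto simp: linear_op_def hinner_simps algebra_simps)
  next
    fix e x assume "x \<in> carrier H"
    then show "c \<odot>\<^bsub>H\<^esub> A (e \<odot>\<^bsub>H\<^esub> x) \<oplus>\<^bsub>H\<^esub> d \<odot>\<^bsub>H\<^esub> S (e \<odot>\<^bsub>H\<^esub> x) =
        e \<odot>\<^bsub>H\<^esub> (c \<odot>\<^bsub>H\<^esub> A x \<oplus>\<^bsub>H\<^esub> d \<odot>\<^bsub>H\<^esub> S x)"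
      using lin S(1) by (intro hinner_eqI) (auto simp: linear_op_def hinner_simps algebra_simps)
  qed auto
  have cong: "linear_op H H D" if "linear_op H H E" "\<And>x. x \<in> carrier H \<Longrightarrow> D x = E x" for D E
    using that by (auto simp: linear_op_def Pi_iff)
  have R: "linear_op H H ?R"
    by (rule cong[OF comb[of "1/2" "1/2"]], rule hinner_eqI) (auto simp: hinner_simps field_simps)
  have M: "linear_op H H ?M"
    by (rule cong[OF comb[of "1/2" "-1/2"]], rule hinner_eqI) (auto simp: hinner_simps field_simps)
  \<comment> \<open>\<open>?M\<close> is skew-adjoint, so i times it is self-adjoint. Its quadratic
    form is, up to sign, the imaginary part of <Ax,x>, and the factor i does not affect
    norms.\<close>
  let ?iM = "\<lambda>x. \<i> \<odot>\<^bsub>H\<^esub> ?M x"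
  have iM: "linear_op H H ?iM"
    by (rule cong[OF comb[of "\<i>/2" "-\<i>/2"]], rule hinner_eqI) (auto simp: hinner_simps field_simps)
  have num': "\<bar>Re (hinner H (A x) x)\<bar> \<le> (hnorm H x)\<^sup>2" "\<bar>Im (hinner H (A x) x)\<bar> \<le> (hnorm H x)\<^sup>2"
    if "x \<in> carrier H" for x
    using num[OF that] abs_Re_le_cmod abs_Im_le_cmod order_trans by blast+
  have Sxx: "hinner H x (A x) = cnj (hinner H (A x) x)" if "x \<in> carrier H" for x
    using that by (intro hinner_commute) auto
  have Rnum: "\<bar>Re (hinner H (?R x) x)\<bar> = \<bar>Re (hinner H (A x) x)\<bar>" if "x \<in> carrier H" for x
    using that by (simp add: hinner_simps S'[OF that that] Sxx)
  have iMnum: "\<bar>Re (hinner H (?iM x) x)\<bar> = \<bar>Im (hinner H (A x) x)\<bar>" if "x \<in> carrier H" for x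
    using that by (simp add: hinner_simps S' Sxx)
  have R_sa: "hinner H (?R x) y = hinner H x (?R y)" and M_sa: "hinner H (?M x) y = - hinner H x (?M y)"
    and iM_sa: "hinner H (?iM x) y = hinner H x (?iM y)" if "x \<in> carrier H" "y \<in> carrier H" for x y
    using that by (simp_all add: hinner_simps S(2) S' algebra_simps)
  show thesis
  proof (rule that[OF R M R_sa M_sa])
    show "hnorm H (?R x) \<le> hnorm H x" if "x \<in> carrier H" for x
      using hnorm_le_if_self_adjoint[OF R R_sa _ that] Rnum num'(1) by simp
    have "hnorm H (?iM x) \<le> hnorm H x" if "x \<in> carrier H" for x
      using hnorm_le_if_self_adjoint[OF iM iM_sa _ that] iMnum num'(2) by simp
    then show "hnorm H (?M x) \<le> hnorm H x" if "x \<in> carrier H" for x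
      using that by (simp add: norm_mult)
    show "?R x \<oplus>\<^bsub>H\<^esub> ?M x = A x" if "x \<in> carrier H" for x
      by (rule hinner_eqI) (use that in \<open>auto simp: hinner_simps field_simps\<close>)
  qed
qed

end

section \<open>Block-diagonal dilations on direct sums\<close>

context pre_hilbert_space
begin

lemma linear_op_zero: "linear_op H H D \<Longrightarrow> D \<zero>\<^bsub>H\<^esub> = \<zero>\<^bsub>H\<^esub>"
  using linear_op_minus[of D "\<zero>\<^bsub>H\<^esub>" "\<zero>\<^bsub>H\<^esub>"] minus_eq_zero_iff[of "\<zero>\<^bsub>H\<^esub>" "\<zero>\<^bsub>H\<^esub>"]
    minus_eq_zero_iff[of "D \<zero>\<^bsub>H\<^esub>" "D \<zero>\<^bsub>H\<^esub>"] by (auto simp: linear_op_def)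

definition sum_inner :: "('i::finite \<Rightarrow> 'a) \<Rightarrow> ('i \<Rightarrow> 'a) \<Rightarrow> complex" where
  "sum_inner f g = (\<Sum>i\<in>UNIV. hinner H (f i) (g i))"

lemma sum_inner_self: "f \<in> UNIV \<rightarrow> carrier H \<Longrightarrow> sum_inner f f = of_real (\<Sum>i\<in>UNIV. (hnorm H (f i))\<^sup>2)"
  by (simp add: sum_inner_def hinner_self Pi_iff)

text \<open>The sum of inner products is already definite, so nothing is identified;
  \<open>mk\<close> merely encodes families injectively into the desired type.\<close>

lemma hilbert_quotient_direct_sum:
  fixes mk :: "('i::finite \<Rightarrow> 'a) \<Rightarrow> 'b"
  assumes "inj mk"
  shows "hilbert_quotient H (UNIV \<rightarrow> carrier H) sum_inner mk"
proof
  fix s t :: "'i \<Rightarrow> 'a"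
  assume s: "s \<in> UNIV \<rightarrow> carrier H" and t: "t \<in> UNIV \<rightarrow> carrier H"
  show "sum_inner s t = cnj (sum_inner t s)"
    unfolding sum_inner_def cnj_sum by (intro sum.cong refl hinner_commute) (use s t in auto)
  show "mk s = mk t \<longleftrightarrow> (\<forall>u\<in>UNIV \<rightarrow> carrier H. sum_inner s u = sum_inner t u)"
  proof
    \<comment> \<open>Testing with the difference of the two families gives its own square length, a
      sum of nonnegative terms.\<close>
    let ?u = "\<lambda>i. s i \<ominus>\<^bsub>H\<^esub> t i"
    assume "\<forall>u\<in>UNIV \<rightarrow> carrier H. sum_inner s u = sum_inner t u"
    moreover have u: "?u \<in> UNIV \<rightarrow> carrier H" using s t by auto
    ultimately have "sum_inner s ?u - sum_inner t ?u = 0" by auto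
    also have "sum_inner s ?u - sum_inner t ?u = sum_inner ?u ?u"
      unfolding sum_inner_def sum_subtractf[symmetric]
      by (intro sum.cong refl) (use s t in \<open>auto simp: hinner_diff_left[of "s _" "t _"] Pi_iff\<close>)
    finally have "(\<Sum>i\<in>UNIV. (hnorm H (?u i))\<^sup>2) = 0"
      unfolding sum_inner_self[OF u] by (simp only: of_real_eq_0_iff)
    then have "?u i = \<zero>\<^bsub>H\<^esub>" for i
      using u by (simp add: sum_nonneg_eq_0_iff Pi_iff)
    then have "s i = t i" for i using s t minus_eq_zero_iff by (auto simp: Pi_iff)
    then show "mk s = mk t" by (metis ext)
  qed (use assms in \<open>auto dest: injD\<close>)
next
  fix s :: "'i \<Rightarrow> 'a"
  assume s: "s \<in> UNIV \<rightarrow> carrier H"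
  show "0 \<le> Re (sum_inner s s)" by (simp add: sum_inner_self[OF s] sum_nonneg)
qed (auto simp: sum_inner_def Pi_iff hinner_simps sum.distrib sum_distrib_left)

end

lemma isometryI:
  assumes "linear_op H K V" "\<And>x. x \<in> carrier H \<Longrightarrow> hinner K (V x) (V x) = hinner H x x"
  shows "isometry H K V"
  using assms by (simp add: isometry_def hnorm_def)

context complete_space
begin

lemma complete_space_direct_sum:
  fixes mk :: "('i::finite \<Rightarrow> 'a) \<Rightarrow> 'b"
  assumes "inj mk"
  shows "complete_space (hilbert_quotient.quot H (UNIV \<rightarrow> carrier H) sum_inner mk)"
proof -
  interpret D: hilbert_quotient H "UNIV \<rightarrow> carrier H" sum_inner mk
    by (rule hilbert_quotient_direct_sum[OF assms])
  have dist: "hdist D.quot (mk f) (mk g) = sqrt (\<Sum>i\<in>UNIV. (hdist H (f i) (g i))\<^sup>2)"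
    if "f \<in> UNIV \<rightarrow> carrier H" "g \<in> UNIV \<rightarrow> carrier H" for f g
  proof -
    have "(\<lambda>i. f i \<ominus>\<^bsub>H\<^esub> g i) \<in> UNIV \<rightarrow> carrier H" using that by auto
    then show ?thesis
      using that by (simp add: hdist_def D.quot_hnorm sum_inner_self del: D.diff_S)
  qed
  show ?thesis
  proof
    fix s assume s: "D.Q.cauchy_seq s"
    have "\<forall>k. \<exists>f. f \<in> UNIV \<rightarrow> carrier H \<and> s k = mk f"
      using D.Q.cauchy_seq_carrier[OF s] by auto
    then obtain f where f: "f k \<in> UNIV \<rightarrow> carrier H" "s k = mk (f k)" for k by metis
    then have fc: "f k i \<in> carrier H" for k i by auto
    have "\<exists>x\<in>carrier H. (\<lambda>k. hdist H (f k i) x) \<longlonglongrightarrow> 0" for i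
    proof (rule cauchy_converges, unfold cauchy_seq_def, intro conjI allI impI fc)
      fix e :: real assume "e > 0"
      with s obtain N where N: "\<And>m n. \<lbrakk>m \<ge> N; n \<ge> N\<rbrakk> \<Longrightarrow> hdist D.quot (s m) (s n) < e"
        unfolding D.Q.cauchy_seq_def by metis
      have "hdist H (f m i) (f n i) < e" if "m \<ge> N" "n \<ge> N" for m n
      proof -
        have "hdist H (f m i) (f n i) = sqrt ((hdist H (f m i) (f n i))\<^sup>2)"
          using fc by (simp add: hdist_def)
        also have "\<dots> \<le> hdist D.quot (s m) (s n)"
          unfolding f(2) dist[OF f(1) f(1)]
          by (intro real_sqrt_le_mono member_le_sum) auto
        finally show ?thesis using N[OF that] by simp
      qed
      then show "\<exists>N. \<forall>m\<ge>N. \<forall>n\<ge>N. hdist H (f m i) (f n i) < e" by blast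
    qed
    then obtain x where x: "x i \<in> carrier H" "(\<lambda>k. hdist H (f k i) (x i)) \<longlonglongrightarrow> 0" for i by metis
    have "(\<lambda>k. sqrt (\<Sum>i\<in>UNIV. (hdist H (f k i) (x i))\<^sup>2)) \<longlonglongrightarrow> sqrt (\<Sum>i\<in>(UNIV :: 'i set). 0\<^sup>2)"
      by (intro tendsto_intros x)
    moreover have "hdist D.quot (s k) (mk x) = sqrt (\<Sum>i\<in>UNIV. (hdist H (f k i) (x i))\<^sup>2)" for k
      unfolding f(2) using x by (intro dist f) auto
    ultimately show "\<exists>y\<in>carrier D.quot. (\<lambda>k. hdist D.quot (s k) y) \<longlonglongrightarrow> 0"
      using x by (intro bexI[of _ "mk x"]) auto
  qed
qed

text \<open>The parameter \<open>c\<close> is the common norm bound of the blocks. With c = 2d the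
  compression is \<open>A i\<close> itself; with c = 1 the blocks are contractions and the
  compression is \<open>A i\<close> divided by 2d.\<close>

lemma block_dilation:
  fixes A :: "'d::finite \<Rightarrow> 'a \<Rightarrow> 'a" and mk :: "('d \<times> bool \<Rightarrow> 'a) \<Rightarrow> 'b" and c :: real
  assumes mk: "inj mk" and c: "c \<ge> 0"
    and A: "\<And>i. bounded_op H H (A i)"
    and num: "\<And>i x. x \<in> carrier H \<Longrightarrow> cmod (hinner H (A i x) x) \<le> (hnorm H x)\<^sup>2"
  obtains K :: "'b hilbert" and V T where "hilbert_space K" "Metric_space (carrier K) (hdist K)"
    "linear_op H K V"
    "\<And>x y. \<lbrakk>x \<in> carrier H; y \<in> carrier H\<rbrakk> \<Longrightarrow> hinner K (V x) (V y) = hinner H x y"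
    "commuting_normal K T"
    "\<And>i x. x \<in> carrier K \<Longrightarrow> hnorm K (T i x) \<le> c * hnorm K x"
    "\<And>i x z. \<lbrakk>x \<in> carrier H; z \<in> carrier H\<rbrakk> \<Longrightarrow>
       hinner K (V z) (T i (V x)) = of_real (c / (2 * real CARD('d))) * hinner H z (A i x)"
proof -
  interpret D: hilbert_quotient H "UNIV \<rightarrow> carrier H" sum_inner mk
    by (rule hilbert_quotient_direct_sum[OF mk])
  let ?K = "D.quot"
  have K: "hilbert_space ?K"
    using complete_space_direct_sum[OF mk] complete_space_iff[OF D.metric_space_quot] by blast
  \<comment> \<open>Both Cartesian parts are indexed by a Boolean, \<open>True\<close> for the
    self-adjoint and \<open>False\<close> for the skew-adjoint one. Bundling their properties lets
    one choice pick the parts for every i.\<close>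
  define parts where "parts i P \<longleftrightarrow> linear_op H H (P True) \<and> linear_op H H (P False) \<and>
      (\<forall>x\<in>carrier H. \<forall>y\<in>carrier H. hinner H (P True x) y = hinner H x (P True y) \<and>
         hinner H (P False x) y = - hinner H x (P False y)) \<and>
      (\<forall>x\<in>carrier H. hnorm H (P True x) \<le> hnorm H x \<and> hnorm H (P False x) \<le> hnorm H x \<and>
         P True x \<oplus>\<^bsub>H\<^esub> P False x = A i x)" for i P
  have "\<exists>P. parts i P" for i
  proof -
    obtain R M where "linear_op H H R" "linear_op H H M"
      "\<And>x y. \<lbrakk>x \<in> carrier H; y \<in> carrier H\<rbrakk> \<Longrightarrow> hinner H (R x) y = hinner H x (R y)"
      "\<And>x y. \<lbrakk>x \<in> carrier H; y \<in> carrier H\<rbrakk> \<Longrightarrow> hinner H (M x) y = - hinner H x (M y)"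
      "\<And>x. x \<in> carrier H \<Longrightarrow> hnorm H (R x) \<le> hnorm H x"
      "\<And>x. x \<in> carrier H \<Longrightarrow> hnorm H (M x) \<le> hnorm H x"
      "\<And>x. x \<in> carrier H \<Longrightarrow> R x \<oplus>\<^bsub>H\<^esub> M x = A i x"
      using cartesian_decomposition[OF A num, of i] by blast
    then show ?thesis by (intro exI[of _ "\<lambda>b. if b then R else M"]) (simp add: parts_def)
  qed
  then obtain P where "\<And>i. parts i (P i)" by metis
  then have P: "linear_op H H (P i True)" "linear_op H H (P i False)"
      "\<And>x y. \<lbrakk>x \<in> carrier H; y \<in> carrier H\<rbrakk> \<Longrightarrow> hinner H (P i True x) y = hinner H x (P i True y)"
      "\<And>x y. \<lbrakk>x \<in> carrier H; y \<in> carrier H\<rbrakk> \<Longrightarrow> hinner H (P i False x) y = - hinner H x (P i False y)"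
      "\<And>x. x \<in> carrier H \<Longrightarrow> hnorm H (P i True x) \<le> hnorm H x"
      "\<And>x. x \<in> carrier H \<Longrightarrow> hnorm H (P i False x) \<le> hnorm H x"
      "\<And>x. x \<in> carrier H \<Longrightarrow> P i True x \<oplus>\<^bsub>H\<^esub> P i False x = A i x" for i
    unfolding parts_def by blast+
  have Plin: "linear_op H H (P i b)" for i b using P(1,2) by (cases b) auto
  have Pcl [simp]: "P i b x \<in> carrier H" if "x \<in> carrier H" for i b x
    using Plin[of i b] that by (auto simp: linear_op_def)
  have Psmult: "P i b (a \<odot>\<^bsub>H\<^esub> x) = a \<odot>\<^bsub>H\<^esub> P i b x" if "x \<in> carrier H" for i b x a
    using Plin[of i b] that by (auto simp: linear_op_def)
  have Pnorm: "hnorm H (P i b x) \<le> hnorm H x" if "x \<in> carrier H" for i b x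
    using P(5,6) that by (cases b) auto
  \<comment> \<open>Block of the i-th operator on the summand k = (j, b): zero unless j = i, and
    otherwise a multiple of the part b of \<open>A i\<close>. Leaving the coefficients
    \<open>a\<close> open covers the operator and its adjoint at once.\<close>
  define B where "B a i k x = (if fst k = i then a (snd k) \<odot>\<^bsub>H\<^esub> P i (snd k) x else \<zero>\<^bsub>H\<^esub>)"
    for a :: "bool \<Rightarrow> complex" and i :: 'd and k :: "'d \<times> bool" and x
  have Bcl [simp]: "B a i k x \<in> carrier H" if "x \<in> carrier H" for a i k x
    using that by (simp add: B_def)
  have Blin: "linear_op H H (B a i k)" for a i k
    unfolding linear_op_def
  proof (intro conjI ballI allI)
    show "B a i k (x \<oplus>\<^bsub>H\<^esub> y) = B a i k x \<oplus>\<^bsub>H\<^esub> B a i k y" if "x \<in> carrier H" "y \<in> carrier H" for x y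
      using that Plin[of i "snd k"] by (auto simp: B_def linear_op_def smult_r_distr[simplified])
    show "B a i k (e \<odot>\<^bsub>H\<^esub> x) = e \<odot>\<^bsub>H\<^esub> B a i k x" if "x \<in> carrier H" for e x
      using that by (intro hinner_eqI) (auto simp: B_def Psmult hinner_simps)
  qed auto
  have Bnorm: "hnorm H (B a i k x) \<le> c * hnorm H x" if "x \<in> carrier H" "\<And>b. cmod (a b) = c" for a i k x
    using that c Pnorm by (auto simp: B_def intro!: mult_left_mono)
  \<comment> \<open>\<open>?a\<close> gives the operator and \<open>?a'\<close> its adjoint: taking
    adjoints preserves the self-adjoint blocks and changes the sign of the skew-adjoint
    ones.\<close>
  let ?a = "\<lambda>_. of_real c" and ?a' = "\<lambda>b. if b then of_real c else - of_real c"
  have a: "cmod (?a b) = c" "cmod (?a' b) = c" for b using c by auto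
  have closed: "(\<lambda>k. B a i k (f k)) \<in> UNIV \<rightarrow> carrier H" if "f \<in> UNIV \<rightarrow> carrier H" for a i f
    by (intro Pi_I Bcl Pi_mem[OF that UNIV_I])
  have bound: "Re (sum_inner (\<lambda>k. B a i k (f k)) (\<lambda>k. B a i k (f k))) \<le> c\<^sup>2 * Re (sum_inner f f)"
    if f: "f \<in> UNIV \<rightarrow> carrier H" and a: "\<And>b. cmod (a b) = c" for a i f
  proof -
    have "(\<Sum>k\<in>UNIV. (hnorm H (B a i k (f k)))\<^sup>2) \<le> (\<Sum>k\<in>UNIV. (c * hnorm H (f k))\<^sup>2)"
    proof (intro sum_mono power_mono)
      fix k
      have fk: "f k \<in> carrier H" using f by auto
      show "hnorm H (B a i k (f k)) \<le> c * hnorm H (f k)" by (rule Bnorm[OF fk a])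
      show "0 \<le> hnorm H (B a i k (f k))" by (rule hnorm_nonneg[OF Bcl[OF fk]])
    qed
    then show ?thesis
      by (simp add: sum_inner_self[OF f] sum_inner_self[OF closed[OF f]] power_mult_distrib sum_distrib_left)
  qed
  define T where "T a i = D.lift (B a i)" for a i
  have T_mk: "T a i (mk f) = mk (\<lambda>k. B a i k (f k))" if "f \<in> UNIV \<rightarrow> carrier H" "\<And>b. cmod (a b) = c" for a i f
    unfolding T_def using D.lift_rho[OF Blin closed bound c] that by blast
  have T_lin: "linear_op ?K ?K (T a i)" if "\<And>b. cmod (a b) = c" for a i
    unfolding T_def using D.lift_linear_op[OF Blin closed bound c] that by blast
  have T_norm: "hnorm ?K (T a i x) \<le> c * hnorm ?K x" if "x \<in> carrier ?K" "\<And>b. cmod (a b) = c" for a i x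
    unfolding T_def using D.lift_hnorm[OF Blin closed bound c] that by blast
  have T_bdd: "bounded_op ?K ?K (T a i)" if "\<And>b. cmod (a b) = c" for a i
    unfolding bounded_op_def by (intro conjI T_lin that exI[of _ c] ballI T_norm)
  \<comment> \<open>On one summand there are two cases: for i = j both blocks are multiples of the
    same part or both are zero, and for distinct i and j at least one of them is zero.\<close>
  have B_comm: "B a i k (B a' j k x) = B a' j k (B a i k x)" if "x \<in> carrier H" for a a' i j k x
  proof (cases "i = j")
    case True
    then show ?thesis
      using that by (intro hinner_eqI) (auto simp: B_def Psmult hinner_simps)
  next
    case False
    then show ?thesis using linear_op_zero[OF Plin] that hnorm_smult[of "\<zero>\<^bsub>H\<^esub>"]
      by (auto simp: B_def)
  qed
  have B_adj: "hinner H (B ?a i k x) y = hinner H x (B ?a' i k y)"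
    if "x \<in> carrier H" "y \<in> carrier H" for i k x y
    using that P(3,4) by (cases "snd k") (auto simp: B_def hinner_simps)
  have T_comm: "T a i (T a' j x) = T a' j (T a i x)"
    if x: "x \<in> carrier ?K" and a: "\<And>b. cmod (a b) = c" "\<And>b. cmod (a' b) = c" for a a' i j x
  proof -
    obtain f where f: "f \<in> UNIV \<rightarrow> carrier H" "x = mk f" using x by auto
    have "(\<lambda>k. B a i k (B a' j k (f k))) = (\<lambda>k. B a' j k (B a i k (f k)))"
      by (intro ext B_comm Pi_mem[OF f(1) UNIV_I])
    then show ?thesis using f closed[OF f(1)] a by (simp add: T_mk)
  qed
  have normal: "commuting_normal ?K (T ?a)"
    unfolding commuting_normal_def
  proof (intro conjI allI ballI)
    fix i
    show "normal_op ?K (T ?a i)"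
    proof (rule D.Q.normal_opI[OF T_bdd[OF a(1)]])
      show "T ?a' i \<in> carrier ?K \<rightarrow> carrier ?K"
        using T_lin[OF a(2)] by (simp add: linear_op_def)
      show "T ?a i (T ?a' i x) = T ?a' i (T ?a i x)" if "x \<in> carrier ?K" for x
        by (rule T_comm[OF that a(1) a(2)])
      fix x y assume "x \<in> carrier ?K" "y \<in> carrier ?K"
      then obtain f g where f: "f \<in> UNIV \<rightarrow> carrier H" "x = mk f"
        and g: "g \<in> UNIV \<rightarrow> carrier H" "y = mk g" by auto
      have "sum_inner (\<lambda>k. B ?a i k (f k)) g = sum_inner f (\<lambda>k. B ?a' i k (g k))"
        unfolding sum_inner_def
        by (intro sum.cong refl B_adj Pi_mem[OF f(1) UNIV_I] Pi_mem[OF g(1) UNIV_I])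
      then show "hinner ?K (T ?a i x) y = hinner ?K x (T ?a' i y)"
        unfolding f(2) g(2) T_mk[OF f(1) a(1)] T_mk[OF g(1) a(2)]
        using f(1) g(1) closed[OF f(1)] closed[OF g(1)] by simp
    qed
  qed (rule T_comm[OF _ a(1) a(1)])
  \<comment> \<open>There are 2d summands, so this weight makes the diagonal embedding
    isometric.\<close>
  define s where "s = complex_of_real (1 / sqrt (2 * real CARD('d)))"
  have s_square: "s * cnj s = of_real (1 / (2 * real CARD('d)))"
    by (simp add: s_def flip: of_real_mult)
  define V where "V x = mk (\<lambda>_. s \<odot>\<^bsub>H\<^esub> x)" for x
  have V_lin: "linear_op H ?K V"
    unfolding linear_op_def
    by (auto simp: V_def smult_r_distr[simplified] smult_assoc1[simplified, symmetric] mult.commute)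
  have V_inner: "hinner ?K (V x) (V y) = hinner H x y" if "x \<in> carrier H" "y \<in> carrier H" for x y
  proof -
    have "hinner ?K (V x) (V y) = of_nat CARD('d \<times> bool) * ((s * cnj s) * hinner H x y)"
      using that by (simp add: V_def sum_inner_def hinner_simps)
    then show ?thesis by (simp add: s_square)
  qed
  have dilation: "hinner ?K (V z) (T ?a i (V x)) = of_real (c / (2 * real CARD('d))) * hinner H z (A i x)"
    if xz: "x \<in> carrier H" "z \<in> carrier H" for i x z
  proof -
    have "hinner ?K (V z) (T ?a i (V x)) = (\<Sum>k\<in>UNIV. hinner H (s \<odot>\<^bsub>H\<^esub> z) (B ?a i k (s \<odot>\<^bsub>H\<^esub> x)))"
      using xz closed[of "\<lambda>_. s \<odot>\<^bsub>H\<^esub> x" ?a i] a(1) by (simp add: V_def T_mk sum_inner_def)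
    also have "\<dots> = (\<Sum>j\<in>UNIV. \<Sum>b\<in>UNIV. hinner H (s \<odot>\<^bsub>H\<^esub> z) (B ?a i (j, b) (s \<odot>\<^bsub>H\<^esub> x)))"
      by (simp add: sum.cartesian_product)
    \<comment> \<open>Only the two summands belonging to i contribute, and together they restore
      both Cartesian parts.\<close>
    also have "\<dots> = (\<Sum>j\<in>UNIV. if j = i then
        s * cnj s * of_real c * (hinner H z (P i True x) + hinner H z (P i False x)) else 0)"
      using xz by (intro sum.cong refl)
        (simp add: B_def UNIV_bool Psmult hinner_simps algebra_simps)
    also have "\<dots> = s * cnj s * of_real c * hinner H z (A i x)"
      using xz by (simp flip: hinner_add_right add: P(7))
    finally show ?thesis by (simp add: s_square)
  qed
  show thesis
    by (rule that[OF K D.metric_space_quot V_lin V_inner normal T_norm[OF _ a(1)] dilation])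
qed

end

section \<open>Spectra of contractions and the dilation theorem\<close>

text \<open>If |z_i| > 1 for a single i, then N_i - z_i has a bounded inverse. That inverse in
  position i, with zeros elsewhere, solves both the left and the right ideal equation, which
  excludes z.\<close>

lemma joint_spectrum_contractions:
  fixes N :: "'d::finite \<Rightarrow> 'a \<Rightarrow> 'a"
  assumes K: "hilbert_space K" and met: "Metric_space (carrier K) (hdist K)"
    and lin: "\<And>i. linear_op K K (N i)"
    and norm: "\<And>i x. x \<in> carrier K \<Longrightarrow> hnorm K (N i x) \<le> hnorm K x"
  shows "joint_spectrum K N \<subseteq> closed_polydisc"
proof
  interpret hilbert_space K by fact
  interpret pre_hilbert_space K using K by (rule hilbert_space_imp_pre)
  fix z assume z: "z \<in> joint_spectrum K N"
  have "cmod (z $ i) \<le> 1" for i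
  proof (rule ccontr)
    define w where "w = z $ i"
    assume "\<not> cmod (z $ i) \<le> 1"
    then have w: "cmod w > 1" by (simp add: w_def)
    define D where "D x = N i x \<ominus>\<^bsub>K\<^esub> w \<odot>\<^bsub>K\<^esub> x" for x
    have Ncl [simp]: "N i x \<in> carrier K" if "x \<in> carrier K" for x
      using lin[of i] that by (auto simp: linear_op_def)
    have Dcl [simp]: "D x \<in> carrier K" if "x \<in> carrier K" for x
      using that by (simp add: D_def)
    have Dlin: "linear_op K K D"
      unfolding linear_op_def
    proof (intro conjI ballI allI)
      show "D (x \<oplus>\<^bsub>K\<^esub> y) = D x \<oplus>\<^bsub>K\<^esub> D y" if "x \<in> carrier K" "y \<in> carrier K" for x y
        by (rule hinner_eqI)
          (use that lin[of i] in \<open>auto simp: D_def linear_op_def hinner_simps algebra_simps\<close>)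
      show "D (c \<odot>\<^bsub>K\<^esub> x) = c \<odot>\<^bsub>K\<^esub> D x" if "x \<in> carrier K" for c x
        by (rule hinner_eqI)
          (use that lin[of i] in \<open>auto simp: D_def linear_op_def hinner_simps algebra_simps\<close>)
    qed auto
    \<comment> \<open>From w x = N_i x - D x and ||N_i x|| \<le> ||x||. It yields injectivity of
      \<open>D\<close> and later the bound on its inverse.\<close>
    have lower: "(cmod w - 1) * hnorm K x \<le> hnorm K (D x)" if x: "x \<in> carrier K" for x
    proof -
      have "w \<odot>\<^bsub>K\<^esub> x = N i x \<oplus>\<^bsub>K\<^esub> (-1) \<odot>\<^bsub>K\<^esub> D x"
        by (rule hinner_eqI) (use x in \<open>auto simp: D_def hinner_simps\<close>)
      then have "cmod w * hnorm K x \<le> hnorm K (N i x) + hnorm K (D x)"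
        using hnorm_triangle[of "N i x" "(-1) \<odot>\<^bsub>K\<^esub> D x"] x by (metis Dcl Ncl hnorm_smult mult_1 norm_minus_cancel norm_one smult_closed')
      then show ?thesis using norm[OF x, of i] by (simp add: left_diff_distrib)
    qed
    have inj: "x = y" if "x \<in> carrier K" "y \<in> carrier K" "D x = D y" for x y
    proof -
      have "D (x \<ominus>\<^bsub>K\<^esub> y) = \<zero>\<^bsub>K\<^esub>"
        using linear_op_minus[OF Dlin that(1,2)] that minus_eq_zero_iff[of "D x" "D y"] by simp
      then have "(cmod w - 1) * hnorm K (x \<ominus>\<^bsub>K\<^esub> y) \<le> 0"
        using lower[of "x \<ominus>\<^bsub>K\<^esub> y"] that by simp
      then have "hnorm K (x \<ominus>\<^bsub>K\<^esub> y) \<le> 0" using w by (simp add: mult_le_0_iff)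
      then have "hnorm K (x \<ominus>\<^bsub>K\<^esub> y) = 0" using that by (simp add: order_antisym)
      then show ?thesis using that by (simp add: minus_eq_zero_iff)
    qed
    have surj: "\<exists>x\<in>carrier K. D x = y" if y: "y \<in> carrier K" for y
    proof -
      \<comment> \<open>A fixed point satisfies w x = N_i x - y, that is D x = y. The map contracts
        by the factor 1/|w| < 1, so Banach's theorem applies.\<close>
      let ?F = "\<lambda>x. inverse w \<odot>\<^bsub>K\<^esub> (N i x \<ominus>\<^bsub>K\<^esub> y)"
      have F: "?F \<in> carrier K \<rightarrow> carrier K" using y by auto
      have contr: "hdist K (?F x) (?F x') \<le> inverse (cmod w) * hdist K x x'"
        if "x \<in> carrier K" "x' \<in> carrier K" for x x'
      proof -
        have "?F x \<ominus>\<^bsub>K\<^esub> ?F x' = inverse w \<odot>\<^bsub>K\<^esub> N i (x \<ominus>\<^bsub>K\<^esub> x')"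
          by (rule hinner_eqI)
            (use that y in \<open>auto simp: hinner_simps linear_op_minus[OF lin] algebra_simps\<close>)
        then have "hdist K (?F x) (?F x') = inverse (cmod w) * hnorm K (N i (x \<ominus>\<^bsub>K\<^esub> x'))"
          using that by (simp add: hdist_def norm_inverse)
        also have "\<dots> \<le> inverse (cmod w) * hdist K x x'"
          unfolding hdist_def using that w by (intro mult_left_mono norm) auto
        finally show ?thesis .
      qed
      have k: "inverse (cmod w) < 1" using w by (simp add: inverse_less_1_iff)
      have ne: "carrier K \<noteq> {}" using M.zero_closed by blast
      have "\<exists>x\<in>carrier K. ?F x = x"
      proof (rule Metric_space.Banach_fixedpoint_thm[OF met complete ne F k])
        show "hdist K (?F x) (?F x') \<le> inverse (cmod w) * hdist K x x'"
          if "x \<in> carrier K" "x' \<in> carrier K" for x x'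
          by (rule contr[OF that])
      qed (erule bexI)
      then obtain x where x: "x \<in> carrier K" "?F x = x" by blast
      have "D x = y"
      proof (rule hinner_eqI)
        fix v assume v: "v \<in> carrier K"
        have "hinner K v x = cnj (inverse w) * (hinner K v (N i x) - hinner K v y)"
          by (subst x(2)[symmetric]) (use x(1) y v in \<open>simp add: hinner_simps\<close>)
        moreover have "cnj w \<noteq> 0" using w by auto
        ultimately have "cnj w * hinner K v x = hinner K v (N i x) - hinner K v y" by simp
        then show "hinner K v (D x) = hinner K v y"
          using x(1) y v by (simp add: D_def hinner_simps)
      qed (use x y in auto)
      then show ?thesis using x by blast
    qed
    define B where "B y = (THE x. x \<in> carrier K \<and> D x = y)" for y
    have B: "B y \<in> carrier K" "D (B y) = y" if "y \<in> carrier K" for y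
    proof -
      have "\<exists>!x. x \<in> carrier K \<and> D x = y" using surj[OF that] inj by blast
      from theI'[OF this] show "B y \<in> carrier K" "D (B y) = y" unfolding B_def by blast+
    qed
    have BD: "B (D x) = x" if "x \<in> carrier K" for x
      by (rule inj) (use B[of "D x"] that in auto)
    have Dadd: "D (x \<oplus>\<^bsub>K\<^esub> y) = D x \<oplus>\<^bsub>K\<^esub> D y" and Dsmult: "D (c \<odot>\<^bsub>K\<^esub> x) = c \<odot>\<^bsub>K\<^esub> D x"
      if "x \<in> carrier K" "y \<in> carrier K" for x y c
      using that Dlin by (simp_all add: linear_op_def)
    have Blin: "linear_op K K B"
      unfolding linear_op_def
    proof (intro conjI ballI allI)
      show "B (x \<oplus>\<^bsub>K\<^esub> y) = B x \<oplus>\<^bsub>K\<^esub> B y" if "x \<in> carrier K" "y \<in> carrier K" for x y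
        by (rule inj) (use that in \<open>simp_all add: B Dadd\<close>)
      show "B (c \<odot>\<^bsub>K\<^esub> x) = c \<odot>\<^bsub>K\<^esub> B x" if "x \<in> carrier K" for c x
        by (rule inj) (use that in \<open>simp_all add: B Dsmult[OF _ M.zero_closed]\<close>)
    qed (use B in auto)
    have "hnorm K (B y) \<le> inverse (cmod w - 1) * hnorm K y" if "y \<in> carrier K" for y
      using lower[OF B(1)[OF that]] B(2)[OF that] w by (simp add: field_simps)
    then have B_bdd: "bounded_op K K B" using Blin by (auto simp: bounded_op_def)
    have zero_bdd: "bounded_op K K (\<lambda>_. \<zero>\<^bsub>K\<^esub>)"
      using hnorm_smult[of "\<zero>\<^bsub>K\<^esub>"]
      by (auto simp: bounded_op_def linear_op_def intro!: exI[of _ 0])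
    let ?B = "\<lambda>j. if j = i then B else (\<lambda>_. \<zero>\<^bsub>K\<^esub>)"
    have bdd: "\<forall>j. bounded_op K K (?B j)" using B_bdd zero_bdd by simp
    have sum: "(\<Oplus>\<^bsub>K\<^esub>j\<in>UNIV. g j) = g i" if "\<And>j. j \<noteq> i \<Longrightarrow> g j = \<zero>\<^bsub>K\<^esub>" "g i \<in> carrier K" for g :: "'d \<Rightarrow> 'a"
    proof -
      have "g = (\<lambda>j. if i = j then g i else \<zero>\<^bsub>K\<^esub>)" using that(1) by auto
      then show ?thesis
        using M.finsum_singleton[of i UNIV "\<lambda>_. g i"] that(2) by auto
    qed
    have left: "(\<Oplus>\<^bsub>K\<^esub>j\<in>UNIV. ?B j (N j x \<ominus>\<^bsub>K\<^esub> (z $ j) \<odot>\<^bsub>K\<^esub> x)) = x" if "x \<in> carrier K" for x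
      using that BD by (subst sum) (auto simp flip: w_def simp flip: D_def)
    have right: "(\<Oplus>\<^bsub>K\<^esub>j\<in>UNIV. N j (?B j x) \<ominus>\<^bsub>K\<^esub> (z $ j) \<odot>\<^bsub>K\<^esub> ?B j x) = x" if x: "x \<in> carrier K" for x
    proof (subst sum)
      show "N i (?B i x) \<ominus>\<^bsub>K\<^esub> (z $ i) \<odot>\<^bsub>K\<^esub> ?B i x = x"
        using B[OF x] by (simp flip: w_def add: D_def)
      show "N j (?B j x) \<ominus>\<^bsub>K\<^esub> (z $ j) \<odot>\<^bsub>K\<^esub> ?B j x = \<zero>\<^bsub>K\<^esub>" if "j \<noteq> i" for j
        using that linear_op_zero[OF lin[of j]] linear_op_zero[OF linear_op_smult]
          minus_eq_zero_iff[of "\<zero>\<^bsub>K\<^esub>" "\<zero>\<^bsub>K\<^esub>"] by simp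
      show "N i (?B i x) \<ominus>\<^bsub>K\<^esub> (z $ i) \<odot>\<^bsub>K\<^esub> ?B i x \<in> carrier K" using B[OF x] by simp
    qed
    have "z \<notin> joint_spectrum K N"
      unfolding joint_spectrum_def mem_Collect_eq not_not
      by (intro conjI exI[of _ ?B] bdd ballI left right)
    then show False using z by contradiction
  qed
  then show "z \<in> closed_polydisc" by (simp add: closed_polydisc_def)
qed

text \<open>Normalize x and compare with the supremum defining \<open>opnorm\<close>.\<close>

lemma (in pre_hilbert_space) contraction_hnorm:
  assumes A: "contraction H A" and x: "x \<in> carrier H"
  shows "hnorm H (A x) \<le> hnorm H x"
proof (cases "x = \<zero>\<^bsub>H\<^esub>")
  case True
  then show ?thesis using A linear_op_zero[of A] by (simp add: contraction_def bounded_op_def)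
next
  case False
  have lin: "linear_op H H A" using A by (simp add: contraction_def bounded_op_def)
  obtain b where b: "\<And>x. x \<in> carrier H \<Longrightarrow> hnorm H (A x) \<le> b * hnorm H x"
    using A unfolding contraction_def bounded_op_def by blast
  have pos: "hnorm H x > 0" using False x by (simp add: order_less_le)
  let ?y = "of_real (inverse (hnorm H x)) \<odot>\<^bsub>H\<^esub> x"
  have y: "?y \<in> carrier H" "hnorm H ?y \<le> 1" using x pos by (simp_all add: norm_inverse, simp add: divide_simps)
  have "hnorm H (A u) \<le> \<bar>b\<bar>" if "u \<in> carrier H" "hnorm H u \<le> 1" for u
  proof -
    have "hnorm H (A u) \<le> \<bar>b\<bar> * hnorm H u"
      using b[OF that(1)] mult_right_mono[of b "\<bar>b\<bar>" "hnorm H u"] that abs_ge_self[of b] hnorm_nonneg[OF that(1)] by linarith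
    also have "\<dots> \<le> \<bar>b\<bar> * 1" using that by (intro mult_left_mono) auto
    finally show ?thesis by simp
  qed
  \<comment> \<open>A real supremum dominates its members only if the set is bounded above, which is
    where boundedness of \<open>A\<close> enters.\<close>
  then have "bdd_above ((\<lambda>u. hnorm H (A u)) ` {u \<in> carrier H. hnorm H u \<le> 1})"
    by (intro bdd_aboveI2[of _ _ "\<bar>b\<bar>"]) auto
  then have "hnorm H (A ?y) \<le> opnorm H H A"
    unfolding opnorm_def using y by (intro cSUP_upper) auto
  also have "\<dots> \<le> 1" using A by (simp add: contraction_def)
  also have "A ?y = of_real (inverse (hnorm H x)) \<odot>\<^bsub>H\<^esub> A x" using lin x by (simp add: linear_op_def)
  finally have "hnorm H (of_real (inverse (hnorm H x)) \<odot>\<^bsub>H\<^esub> A x) \<le> 1" .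
  moreover have "A x \<in> carrier H" using lin x by (auto simp: linear_op_def)
  ultimately have "inverse (hnorm H x) * hnorm H (A x) \<le> 1" using x by (simp add: norm_inverse)
  then show ?thesis using pos by (simp add: field_simps)
qed

lemma (in pre_hilbert_space) opnorm_le:
  assumes "\<And>x. x \<in> carrier H \<Longrightarrow> hnorm K (T x) \<le> c * hnorm H x" "c \<ge> 0"
  shows "opnorm H K T \<le> c"
  unfolding opnorm_def
proof (rule cSUP_least)
  show "{x \<in> carrier H. hnorm H x \<le> 1} \<noteq> {}" using hnorm_zero by (auto intro!: exI[of _ "\<zero>\<^bsub>H\<^esub>"])
  fix x assume x: "x \<in> {x \<in> carrier H. hnorm H x \<le> 1}"
  then have "hnorm K (T x) \<le> c * hnorm H x" using assms by auto
  also have "\<dots> \<le> c * 1" using x assms by (intro mult_left_mono) auto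
  finally show "hnorm K (T x) \<le> c" by simp
qed

text \<open>The isometry is the embedding into the completion followed by the diagonal embedding,
  with c = 2d in \<open>block_dilation\<close>.\<close>

lemma contractions_dilation:
  fixes H :: "'a hilbert" and A :: "'d::finite \<Rightarrow> 'a \<Rightarrow> 'a"
  assumes H: "hilbert_space H" and A: "\<And>i. contraction H (A i)"
  shows "\<exists>(K :: (nat \<Rightarrow> 'a) hilbert) V T.
     hilbert_space K \<and> isometry H K V \<and> commuting_normal K T \<and>
     (\<forall>i. opnorm K K (T i) \<le> 2 * real CARD('d)) \<and>
     (\<forall>i. \<forall>x\<in>carrier H. A i x = adj H K V (T i (V x)))"
proof -
  interpret pre_hilbert_space H using H by (rule hilbert_space_imp_pre)
  have A_bdd: "bounded_op H H (A i)" for i using A by (simp add: contraction_def)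
  have Acl: "A i x \<in> carrier H" if "x \<in> carrier H" for i x
    using A_bdd[of i] that by (auto simp: bounded_op_def linear_op_def)
  have num: "cmod (hinner H (A i x) x) \<le> (hnorm H x)\<^sup>2" if x: "x \<in> carrier H" for i x
  proof -
    have "cmod (hinner H (A i x) x) \<le> hnorm H (A i x) * hnorm H x"
      using x Acl by (intro cauchy_schwarz)
    also have "\<dots> \<le> hnorm H x * hnorm H x"
      using x A contraction_hnorm by (intro mult_right_mono) auto
    finally show ?thesis by (simp add: power2_eq_square)
  qed
  obtain G :: "(nat \<Rightarrow> 'a) hilbert" and J where G: "complete_space G" and J: "linear_op H G J"
    "\<And>x y. \<lbrakk>x \<in> carrier H; y \<in> carrier H\<rbrakk> \<Longrightarrow> hinner G (J x) (J y) = hinner H x y"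
    and extend: "\<forall>A. bounded_op H H A \<and> (\<forall>x\<in>carrier H. cmod (hinner H (A x) x) \<le> (hnorm H x)\<^sup>2) \<longrightarrow>
       (\<exists>B. bounded_op G G B \<and> (\<forall>x\<in>carrier G. cmod (hinner G (B x) x) \<le> (hnorm G x)\<^sup>2) \<and>
         (\<forall>x\<in>carrier H. B (J x) = J (A x)))"
    by (rule completion_exists[OF pre_hilbert_space_axioms]) blast
  interpret G: complete_space G by fact
  have "\<forall>i. \<exists>B. bounded_op G G B \<and> (\<forall>x\<in>carrier G. cmod (hinner G (B x) x) \<le> (hnorm G x)\<^sup>2) \<and>
         (\<forall>x\<in>carrier H. B (J x) = J (A i x))"
    using extend A_bdd num by blast
  from choice[OF this] obtain B where B: "\<forall>i. bounded_op G G (B i) \<and>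
      (\<forall>x\<in>carrier G. cmod (hinner G (B i x) x) \<le> (hnorm G x)\<^sup>2) \<and>
      (\<forall>x\<in>carrier H. B i (J x) = J (A i x))" ..
  \<comment> \<open>A finite family of sequences is a function on a countable index type; reading it
    along the surjection \<open>from_nat\<close> codes it as one sequence, and \<open>mk\<close> is
    injective.\<close>
  let ?e = "from_nat :: nat \<Rightarrow> ('d \<times> bool) \<times> nat"
  define mk :: "('d \<times> bool \<Rightarrow> nat \<Rightarrow> 'a) \<Rightarrow> nat \<Rightarrow> 'a"
    where "mk f n = f (fst (?e n)) (snd (?e n))" for f n
  have mk: "inj mk"
  proof (rule injI, intro ext)
    fix f g and k :: "'d \<times> bool" and n :: nat assume "mk f = mk g"
    then have "mk f (to_nat (k, n)) = mk g (to_nat (k, n))" by simp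
    then show "f k n = g k n" by (simp add: mk_def)
  qed
  obtain K :: "(nat \<Rightarrow> 'a) hilbert" and V T where K: "hilbert_space K" "Metric_space (carrier K) (hdist K)"
    and V: "linear_op G K V"
    "\<And>x y. \<lbrakk>x \<in> carrier G; y \<in> carrier G\<rbrakk> \<Longrightarrow> hinner K (V x) (V y) = hinner G x y"
    and T: "commuting_normal K T" 
    "\<And>i x. x \<in> carrier K \<Longrightarrow> hnorm K (T i x) \<le> (2 * real CARD('d)) * hnorm K x"
    "\<And>i x z. \<lbrakk>x \<in> carrier G; z \<in> carrier G\<rbrakk> \<Longrightarrow>
       hinner K (V z) (T i (V x)) = of_real (2 * real CARD('d) / (2 * real CARD('d))) * hinner G z (B i x)"
  proof (rule G.block_dilation[OF mk, of "2 * real CARD('d)" B])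
    show "cmod (hinner G (B i x) x) \<le> (hnorm G x)\<^sup>2" if "x \<in> carrier G" for i x
      using B that by blast
  qed (use B in simp_all)
  interpret K: pre_hilbert_space K using K(1) by (rule hilbert_space_imp_pre)
  have Jcl: "J x \<in> carrier G" if "x \<in> carrier H" for x using J that by (auto simp: linear_op_def)
  have "isometry H K (V \<circ> J)"
    by (rule isometryI) (use J V in \<open>auto simp: linear_op_def Pi_iff\<close>)
  moreover have "opnorm K K (T i) \<le> 2 * real CARD('d)" for i
    by (rule K.opnorm_le) (use T(2) in auto)
  \<comment> \<open>The extensions satisfy B J = J A, so the compression to G maps the image of H
    into itself and the vector required by \<open>adj_eqI\<close> is already in H.\<close>
  moreover have "A i x = adj H K (V \<circ> J) (T i ((V \<circ> J) x))" if x: "x \<in> carrier H" for i x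
  proof (rule adj_eqI[symmetric])
    fix z assume z: "z \<in> carrier H"
    have "hinner K (V (J z)) (T i (V (J x))) = hinner G (J z) (B i (J x))"
      using T(3)[OF Jcl[OF x] Jcl[OF z]] by simp
    also have "\<dots> = hinner H z (A i x)" using B J x z Acl by simp
    finally show "hinner K ((V \<circ> J) z) (T i ((V \<circ> J) x)) = hinner H z (A i x)" by simp
  qed (use Acl x in simp)
  ultimately show ?thesis using K(1) T(1) by blast
qed

section \<open>Matrices: numerical radius bounds from \<open>W_max\<close>, and dilations into
  \<open>W_min\<close>\<close>

lemma hinner_cvec_space: "hinner cvec_space x y = (\<Sum>i\<in>UNIV. x $ i * cnj (y $ i))"
  by (simp add: cvec_space_def)

lemma hinner_mat_adj:
  "hinner cvec_space (mat_adj X *v v) w = cnj (hinner cvec_space (X *v w) v)"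
proof -
  have "hinner cvec_space (mat_adj X *v v) w = (\<Sum>i\<in>UNIV. \<Sum>j\<in>UNIV. cnj (X $ j $ i) * v $ j * cnj (w $ i))"
    by (simp add: hinner_cvec_space matrix_vector_mult_def mat_adj_def map_matrix_def transpose_def sum_distrib_right)
  also have "\<dots> = (\<Sum>j\<in>UNIV. \<Sum>i\<in>UNIV. cnj (X $ j $ i) * v $ j * cnj (w $ i))"
    by (rule sum.swap)
  also have "\<dots> = cnj (hinner cvec_space (X *v w) v)"
    by (simp add: hinner_cvec_space matrix_vector_mult_def sum_distrib_left sum_distrib_right mult_ac)
  finally show ?thesis .
qed

lemma scaleR_matrix_vector:
  fixes X :: "complex ^ 'n::finite ^ 'm"
  shows "(r *\<^sub>R X) *v v = r *\<^sub>R (X *v v)"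
  by (simp add: matrix_vector_mult_def vec_eq_iff scaleR_sum_right)

text \<open>For |u| \<le> 1 the polydisc satisfies Re (u z_i) \<le> 1, so Re (u X_i) \<le> I.
  Choosing the phase u to make u <X_i v, v> equal to its modulus gives the bound.\<close>

lemma W_max_numerical_radius:
  fixes X :: "'d::finite \<Rightarrow> complex ^ 'n::finite ^ 'n"
  assumes "X \<in> W_max closed_polydisc"
  shows "cmod (hinner cvec_space (X i *v v) v) \<le> (norm v)\<^sup>2"
proof -
  define q where "q = hinner cvec_space (X i *v v) v"
  define u where "u = (if q = 0 then 0 else cnj (sgn q))"
  have u: "cmod u \<le> 1" "u * q = of_real (cmod q)"
  proof -
    have "cnj q * q = (of_real (cmod q))\<^sup>2"
      using complex_norm_square[of q] by (simp add: mult.commute)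
    then show "u * q = of_real (cmod q)" by (simp add: u_def sgn_eq power2_eq_square)
  qed (simp add: u_def norm_sgn)
  \<comment> \<open>The linear functional that reads only coordinate i, rotated by u.\<close>
  let ?\<alpha> = "axis i u :: complex ^ 'd"
  have sum: "(\<Sum>j\<in>UNIV. f (?\<alpha> $ j) j) = f u i" if "\<And>j. f 0 j = 0" for f :: "complex \<Rightarrow> 'd \<Rightarrow> 'z::comm_monoid_add"
  proof -
    have "(\<Sum>j\<in>UNIV. f (?\<alpha> $ j) j) = (\<Sum>j\<in>UNIV. if j = i then f u i else 0)"
      using that by (intro sum.cong) (auto simp: axis_def)
    then show ?thesis by simp
  qed
  have "Re (\<Sum>j\<in>UNIV. ?\<alpha> $ j * z $ j) \<le> 1" if "z \<in> closed_polydisc" for z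
  proof -
    have "Re (u * z $ i) \<le> cmod u * cmod (z $ i)" using complex_Re_le_cmod[of "u * z $ i"] by (simp add: norm_mult)
    also have "\<dots> \<le> 1" using that u by (simp add: closed_polydisc_def mult_le_one)
    finally show ?thesis using sum[of "\<lambda>a j. a * z $ j"] by simp
  qed
  with assms have "loewner_le (mat_Re (\<Sum>j\<in>UNIV. map_matrix ((*) (?\<alpha> $ j)) (X j))) (mat (of_real 1))"
    unfolding W_max_def by blast
  moreover have "(\<Sum>j\<in>UNIV. map_matrix ((*) (?\<alpha> $ j)) (X j)) = map_matrix ((*) u) (X i)"
    by (rule sum) (simp add: map_matrix_def vec_eq_iff)
  ultimately have "Re (hinner cvec_space ((mat (of_real 1) - mat_Re (map_matrix ((*) u) (X i))) *v v) v) \<ge> 0"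
    by (simp add: loewner_le_def psd_def)
  moreover have "hinner cvec_space ((mat (of_real 1) - mat_Re (map_matrix ((*) u) (X i))) *v v) v =
      hinner cvec_space v v - (1/2) * (u * q + cnj (u * q))"
  proof -
    let ?Y = "map_matrix ((*) u) (X i)"
    have Y: "hinner cvec_space (?Y *v v) v = u * q"
      by (simp add: q_def hinner_cvec_space matrix_vector_mult_def map_matrix_def sum_distrib_left mult_ac)
    have "hinner cvec_space ((mat (of_real 1) - mat_Re ?Y) *v v) v =
        hinner cvec_space v v - (1/2) * (hinner cvec_space (?Y *v v) v + hinner cvec_space (mat_adj ?Y *v v) v)"
      by (simp add: mat_Re_def matrix_vector_mult_diff_rdistrib matrix_vector_mult_add_rdistrib
          scaleR_matrix_vector hinner_cvec_space algebra_simps sum_subtractf sum.distrib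
          sum_distrib_left scaleR_conv_of_real[where 'a = complex])
    then show ?thesis by (simp only: Y hinner_mat_adj)
  qed
  ultimately have "cmod q \<le> Re (hinner cvec_space v v)" using u by simp
  also have "\<dots> = (norm v)\<^sup>2"
    using hnorm_cvec_space[of v] unfolding hnorm_def by (metis norm_ge_zero real_sqrt_ge_0_iff real_sqrt_pow2)
  finally show ?thesis by (simp add: q_def)
qed

text \<open>The case c = 1 of \<open>block_dilation\<close>: the dilating operators are
  contractions, so \<open>joint_spectrum_contractions\<close> places their joint spectrum in the
  polydisc.\<close>

lemma W_max_dilation:
  fixes X :: "'d::finite \<Rightarrow> complex ^ 'n::finite ^ 'n"
  assumes X: "X \<in> W_max closed_polydisc"
  shows "(\<lambda>i. (1 / (2 * real CARD('d))) *\<^sub>R X i) \<in> W_min closed_polydisc"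
proof -
  let ?H = "cvec_space :: (complex ^ 'n) hilbert"
  have carrier [simp]: "carrier ?H = UNIV" by (simp add: cvec_space_def)
  \<comment> \<open>Here \<open>hdist\<close> is the ordinary distance of the type, so completeness
    can be read off sequentially and the space enters \<open>block_dilation\<close> as it
    stands.\<close>
  have "Metric_space (carrier ?H) (hdist ?H)"
    unfolding carrier hdist_cvec_space by (rule Met_TC.Metric_space_axioms)
  then interpret H: complete_space ?H
    using complete_space_iff hilbert_space_cvec_space by blast
  have bdd: "bounded_op ?H ?H ((*v) (X i))" for i
  proof -
    have "\<exists>b. \<forall>x. norm (X i *v x) \<le> b * norm x"
      using linear_bounded[OF matrix_vector_mul_linear[of "X i"]] by blast
    then show ?thesis
      by (auto simp: bounded_op_def linear_op_def hnorm_cvec_space)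
        (simp_all add: cvec_space_def matrix_vector_right_distrib vector_scalar_commute)
  qed
  \<comment> \<open>Coding through the entries of the vectors puts the direct sum into the type
    \<open>nat \<Rightarrow> complex\<close> prescribed by \<open>W_min\<close>.\<close>
  let ?e = "from_nat :: nat \<Rightarrow> ('d \<times> bool) \<times> 'n"
  define mk :: "('d \<times> bool \<Rightarrow> complex ^ 'n) \<Rightarrow> nat \<Rightarrow> complex"
    where "mk f n = f (fst (?e n)) $ snd (?e n)" for f n
  have mk: "inj mk"
  proof (rule injI, rule ext, unfold vec_eq_iff, rule allI)
    fix f g and k :: "'d \<times> bool" and n :: 'n assume "mk f = mk g"
    then have "mk f (to_nat (k, n)) = mk g (to_nat (k, n))" by simp
    then show "f k $ n = g k $ n" by (simp add: mk_def)
  qed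
  have num: "cmod (hinner ?H (X i *v x) x) \<le> (hnorm ?H x)\<^sup>2" for i x
    using W_max_numerical_radius[OF X] by (simp add: hnorm_cvec_space)
  obtain K :: "(nat \<Rightarrow> complex) hilbert" and V T where K: "hilbert_space K" "Metric_space (carrier K) (hdist K)"
    and V: "linear_op ?H K V" "\<And>x y. hinner K (V x) (V y) = hinner ?H x y"
    and T: "commuting_normal K T" 
    "\<And>i x. x \<in> carrier K \<Longrightarrow> hnorm K (T i x) \<le> 1 * hnorm K x"
    "\<And>i x z. hinner K (V z) (T i (V x)) = of_real (1 / (2 * real CARD('d))) * hinner ?H z (X i *v x)"
    using H.block_dilation[OF mk, of 1 "\<lambda>i. (*v) (X i)"] bdd num by auto
  have "linear_op K K (T i)" for i
    using T(1) by (simp add: commuting_normal_def normal_op_def bounded_op_def)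
  then have "joint_spectrum K T \<subseteq> closed_polydisc"
    using T(2) by (intro joint_spectrum_contractions K) auto
  moreover have "((1 / (2 * real CARD('d))) *\<^sub>R X i) *v v = adj ?H K V (T i (V v))" for i v
  proof (rule H.adj_eqI[symmetric])
    show "hinner K (V z) (T i (V v)) = hinner ?H z (((1 / (2 * real CARD('d))) *\<^sub>R X i) *v v)" for z
      unfolding T(3) scaleR_matrix_vector
      by (simp add: hinner_cvec_space sum_distrib_left scaleR_conv_of_real[where 'a = complex] mult_ac)
  qed simp
  moreover have "isometry ?H K V" using V by (intro isometryI)
  ultimately show ?thesis unfolding W_min_def using K T(1) by blast
qed

theorem corollary7p10:
  shows
    "(\<forall>(H :: 'a hilbert) (A :: 'd::finite \<Rightarrow> 'a \<Rightarrow> 'a).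
        hilbert_space H \<and> (\<forall>i. contraction H (A i)) \<longrightarrow>
        (\<exists>(K :: (nat \<Rightarrow> 'a) hilbert) V T.
           hilbert_space K \<and> isometry H K V \<and> commuting_normal K T \<and>
           (\<forall>i. opnorm K K (T i) \<le> 2 * real CARD('d)) \<and>
           (\<forall>i. \<forall>x\<in>carrier H. A i x = adj H K V (T i (V x)))))
     \<and> (W_max closed_polydisc :: ('d \<Rightarrow> complex ^ 'n::finite ^ 'n) set)
         \<subseteq> scale_tuples (2 * real CARD('d)) (W_min closed_polydisc)"
proof (intro conjI allI impI subsetI)
  fix H :: "'a hilbert" and A :: "'d \<Rightarrow> 'a \<Rightarrow> 'a"
  assume "hilbert_space H \<and> (\<forall>i. contraction H (A i))"
  then show "\<exists>(K :: (nat \<Rightarrow> 'a) hilbert) V T.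
     hilbert_space K \<and> isometry H K V \<and> commuting_normal K T \<and>
     (\<forall>i. opnorm K K (T i) \<le> 2 * real CARD('d)) \<and>
     (\<forall>i. \<forall>x\<in>carrier H. A i x = adj H K V (T i (V x)))"
    by (intro contractions_dilation) auto
next
  fix X :: "'d \<Rightarrow> complex ^ 'n ^ 'n"
  assume "X \<in> W_max closed_polydisc"
  from W_max_dilation[OF this]
  show "X \<in> scale_tuples (2 * real CARD('d)) (W_min closed_polydisc)"
    unfolding scale_tuples_def by (rule rev_image_eqI) simp
qed

end
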